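(* Let $\Phi$ be an irreducible root system and $n\ge 1$. Then the characteristic quasi-polynomial of the Linial arrangement $\mathcal{A}_\Phi^{[1,n]}$ satisfies $$\chi_{\mathrm{quasi}}(\mathcal{A}_\Phi^{[1,n]},q)=\big(E_\Phi(S^{n+1})\,L_{\bar A}\big)(q),$$ i.e. if $E_\Phi(t)=\sum_i a_it^i$ then $\chi_{\mathrm{quasi}}(\mathcal{A}_\Phi^{[1,n]},q)=\sum_i a_i L_{\bar A}(q-(n+1)i)$.
   Context: Let $V=\mathbb{R}^\ell$ with inner product $(\cdot,\cdot)$, $\Phi\subset V$ an irreducible crystallographic root system of rank $\ell$ with Weyl group $W$, positive system $\Phi^+$, simple roots $\alpha_1,\dots,\alpha_\ell$. Write the highest root as $\tilde\alpha=\sum_{i=1}^\ell c_i\alpha_i$ ($c_i\in\mathbb{Z}_{>0}$), and set $\alpha_0=-\tilde\alpha$, $c_0=1$. For $\alpha\in\Phi^+$, $k\in\mathbb{Z}$, $H_{\alpha,k}=\{x\mid(\alpha,x)=k\}$, and $\mathcal{A}_\Phi^{[a,b]}=\{H_{\alpha,k}\mid\alpha\in\Phi^+,a\le k\le b\}$. Coweight lattice $Z(\Phi)=\{x\mid(\alpha_i,x)\in\mathbb{Z}\ \forall i\}$; coroot lattice $\check Q(\Phi)=\sum_{\alpha\in\Phi}\mathbb{Z}\frac{2\alpha}{(\alpha,\alpha)}$; $f=\#Z(\Phi)/\check Q(\Phi)$. Characteristic quasi-polynomial: $\chi_{\mathrm{quasi}}(\mathcal{A}_\Phi^{[a,b]},q)$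 is the quasi-polynomial equal, for all large $q$, to the number of $\bar x\in Z(\Phi)/qZ(\Phi)$ with $(\alpha,x)\not\equiv k\pmod q$ for all $\alpha\in\Phi^+$, $a\le k\le b$. Fundamental alcove $A^\circ=\{x\mid(\alpha_i,x)>0\ (1\le i\le\ell),\ (\tilde\alpha,x)<1\}$ with closure $\bar A$; $L_{\bar A}(q)=\#(q\bar A\cap Z(\Phi))$ for $q>0$, which is a quasi-polynomial in $q$ and is extended to all $q\in\mathbb{Z}$ as such. For $w\in W$, $\mathrm{asc}(w)=\sum_{0\le i\le\ell,\ w(\alpha_i)>0}c_i$ (where $w(\alpha_i)>0$ means $w(\alpha_i)\in\Phi^+$). The generalized Eulerian polynomial is $E_\Phi(t)=\frac1f\sum_{w\in W}t^{\mathrm{asc}(w)}$. The shift operator $S$ acts on functions by $(Sg)(t)=g(t-1)$, and $(\sum_k a_kS^k)g(t)=\sum_k a_k g(t-k)$. *)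

theory Defs
  imports
    "HOL-Analysis.Analysis"
    "HOL-Computational_Algebra.Polynomial"
    "HOL-Library.Real_Mod"
begin

text \<open>
  The ambient space \<open>V\<close> is an arbitrary Euclidean space; its dimension \<open>DIM('a) \<ge> 1\<close> is
  the rank \<open>l\<close>. Simple roots are given as a family indexed by \<open>{1..DIM('a)}\<close>; index \<open>0\<close>
  is reserved for the negative of the highest root.
\<close>

section \<open>Root systems\<close>

definition reflection :: "'a::euclidean_space \<Rightarrow> 'a \<Rightarrow> 'a" where
  "reflection \<beta> x = x - (2 * (\<beta> \<bullet> x) / (\<beta> \<bullet> \<beta>)) *\<^sub>R \<beta>"

text \<open>Root systems are crystallographic and reduced, and of full rank.\<close>

definition root_system :: "'a::euclidean_space set \<Rightarrow> bool" where
  "root_system \<Phi> \<longleftrightarrow>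
     finite \<Phi> \<and> 0 \<notin> \<Phi> \<and> span \<Phi> = UNIV \<and>
     (\<forall>\<alpha>\<in>\<Phi>. \<forall>\<beta>\<in>\<Phi>. reflection \<alpha> \<beta> \<in> \<Phi>) \<and>
     (\<forall>\<alpha>\<in>\<Phi>. \<forall>\<beta>\<in>\<Phi>. 2 * (\<alpha> \<bullet> \<beta>) / (\<alpha> \<bullet> \<alpha>) \<in> \<int>) \<and>
     (\<forall>\<alpha>\<in>\<Phi>. \<forall>r. r *\<^sub>R \<alpha> \<in> \<Phi> \<longrightarrow> r = 1 \<or> r = -1)"

definition irreducible_root_system :: "'a::euclidean_space set \<Rightarrow> bool" where
  "irreducible_root_system \<Phi> \<longleftrightarrow>
     root_system \<Phi> \<and>
     \<not> (\<exists>\<Phi>1 \<Phi>2. \<Phi>1 \<noteq> {} \<and> \<Phi>2 \<noteq> {} \<and> \<Phi>1 \<union> \<Phi>2 = \<Phi> \<and> \<Phi>1 \<inter> \<Phi>2 = {} \<and>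
          (\<forall>\<alpha>\<in>\<Phi>1. \<forall>\<beta>\<in>\<Phi>2. \<alpha> \<bullet> \<beta> = 0))"

text \<open>Reflections are involutions, so the monoid they generate is already a group.\<close>

inductive_set weyl_group :: "('a::euclidean_space) set \<Rightarrow> ('a \<Rightarrow> 'a) set"
  for \<Phi> :: "'a set" where
  weyl_id: "id \<in> weyl_group \<Phi>"
| weyl_reflection: "w \<in> weyl_group \<Phi> \<Longrightarrow> \<beta> \<in> \<Phi> \<Longrightarrow> reflection \<beta> \<circ> w \<in> weyl_group \<Phi>"

definition simple_cone :: "(nat \<Rightarrow> 'a::euclidean_space) \<Rightarrow> 'a set" where
  "simple_cone \<alpha> = {\<Sum>i=1..DIM('a). real (m i) *\<^sub>R \<alpha> i | m :: nat \<Rightarrow> nat. True}"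

definition positive_roots :: "'a::euclidean_space set \<Rightarrow> (nat \<Rightarrow> 'a) \<Rightarrow> 'a set" where
  "positive_roots \<Phi> \<alpha> = \<Phi> \<inter> simple_cone \<alpha>"

definition simple_roots :: "'a::euclidean_space set \<Rightarrow> (nat \<Rightarrow> 'a) \<Rightarrow> bool" where
  "simple_roots \<Phi> \<alpha> \<longleftrightarrow>
     \<alpha> ` {1..DIM('a)} \<subseteq> \<Phi> \<and> inj_on \<alpha> {1..DIM('a)} \<and> independent (\<alpha> ` {1..DIM('a)}) \<and>
     (\<forall>\<beta>\<in>\<Phi>. \<beta> \<in> positive_roots \<Phi> \<alpha> \<or> - \<beta> \<in> positive_roots \<Phi> \<alpha>)"

definition highest_root :: "'a::euclidean_space set \<Rightarrow> (nat \<Rightarrow> 'a) \<Rightarrow> 'a \<Rightarrow> bool" where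
  "highest_root \<Phi> \<alpha> \<theta> \<longleftrightarrow> \<theta> \<in> \<Phi> \<and> (\<forall>\<beta>\<in>\<Phi>. \<theta> - \<beta> \<in> simple_cone \<alpha>)"

section \<open>Lattices\<close>

definition coweight_lattice :: "(nat \<Rightarrow> 'a::euclidean_space) \<Rightarrow> 'a set" where
  "coweight_lattice \<alpha> = {x. \<forall>i\<in>{1..DIM('a)}. \<alpha> i \<bullet> x \<in> \<int>}"

definition coroot_lattice :: "'a::euclidean_space set \<Rightarrow> 'a set" where
  "coroot_lattice \<Phi> =
     {\<Sum>\<beta>\<in>\<Phi>. of_int (m \<beta>) *\<^sub>R ((2 / (\<beta> \<bullet> \<beta>)) *\<^sub>R \<beta>) | m :: 'a \<Rightarrow> int. True}"

text \<open>The set of cosets \<open>Z / M\<close>, for additive subgroups \<open>M \<subseteq> Z\<close>.\<close>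

definition lattice_quotient :: "'a::euclidean_space set \<Rightarrow> 'a set \<Rightarrow> 'a set set" where
  "lattice_quotient Z M = Z // {(x, y). x \<in> Z \<and> y \<in> Z \<and> x - y \<in> M}"

definition lattice_index :: "'a::euclidean_space set \<Rightarrow> (nat \<Rightarrow> 'a) \<Rightarrow> nat" where
  "lattice_index \<Phi> \<alpha> = card (lattice_quotient (coweight_lattice \<alpha>) (coroot_lattice \<Phi>))"

section \<open>Quasi-polynomials\<close>

definition quasi_polynomial :: "(int \<Rightarrow> real) \<Rightarrow> bool" where
  "quasi_polynomial g \<longleftrightarrow>
     (\<exists>\<rho>>0. \<exists>p :: int \<Rightarrow> real poly. \<forall>q. g q = poly (p (q mod \<rho>)) (of_int q))"

text \<open>
  A quasi-polynomial is determined by its values at large arguments, so the two definite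
  descriptions below have at most one solution.
\<close>

lemma quasi_polynomial_eqI:
  assumes "quasi_polynomial g" "quasi_polynomial h" "eventually (\<lambda>q. g q = h q) at_top"
  shows "g = h"
proof
  fix q :: int
  obtain r p where r: "r > 0" "\<And>q. g q = poly (p (q mod r)) (of_int q)"
    using assms(1) unfolding quasi_polynomial_def by blast
  obtain s p' where s: "s > 0" "\<And>q. h q = poly (p' (q mod s)) (of_int q)"
    using assms(2) unfolding quasi_polynomial_def by blast
  obtain N where N: "\<And>x. x \<ge> N \<Longrightarrow> g x = h x"
    using assms(3) unfolding eventually_at_top_linorder by blast
  define F where "F = (\<lambda>n. q + r * s * int n)"
  have inj: "inj (\<lambda>n. real_of_int (F n))"
    using r s by (auto simp: F_def inj_on_def)
  have root: "poly (p (q mod r) - p' (q mod s)) (of_int (F n)) = 0"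
    if "n \<ge> nat \<bar>N - q\<bar>" for n
  proof -
    have "int n \<le> r * s * int n"
      using r s mult_right_mono[of 1 "r * s" "int n"]
      by (metis int_one_le_iff_zero_less mult_1 mult_pos_pos of_nat_0_le_iff)
    then have "F n \<ge> N" using that by (simp add: F_def)
    moreover have "F n mod r = q mod r"
      by (simp add: F_def mult.assoc)
    moreover have "F n mod s = q mod s"
      by (simp add: F_def mult.commute[of r s] mult.assoc)
    ultimately show ?thesis using N[of "F n"] r(2)[of "F n"] s(2)[of "F n"] by simp
  qed
  have "(\<lambda>n. real_of_int (F n)) ` {nat \<bar>N - q\<bar>..} \<subseteq> {x. poly (p (q mod r) - p' (q mod s)) x = 0}"
    using root by blast
  moreover have "infinite ((\<lambda>n. real_of_int (F n)) ` {nat \<bar>N - q\<bar>..})"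
    using inj by (subst finite_image_iff) (auto intro: inj_on_subset simp: infinite_Ici)
  ultimately have "p (q mod r) - p' (q mod s) = 0"
    using poly_roots_finite finite_subset by blast
  then show "g q = h q" using r(2)[of q] s(2)[of q] by simp
qed

text \<open>
  The reduction modulo \<open>q\<close> of the arrangement \<open>{H_{\<beta>,k} | \<beta> > 0, a \<le> k \<le> b}\<close> is taken through
  the defining equations \<open>\<beta> \<bullet> x = k\<close>. Here \<open>\<beta> \<bullet> x\<close> is an integer, whose residue modulo \<open>q\<close>
  depends only on the class \<open>X\<close> of \<open>x\<close>.
\<close>

definition complement_count ::
    "'a::euclidean_space set \<Rightarrow> (nat \<Rightarrow> 'a) \<Rightarrow> int \<Rightarrow> int \<Rightarrow> int \<Rightarrow> nat" where
  "complement_count \<Phi> \<alpha> a b q =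
     card {X \<in> lattice_quotient (coweight_lattice \<alpha>) ((*\<^sub>R) (of_int q) ` coweight_lattice \<alpha>).
             \<forall>x\<in>X. \<forall>\<beta>\<in>positive_roots \<Phi> \<alpha>. \<forall>k\<in>{a..b}.
               \<not> [\<beta> \<bullet> x = of_int k] (rmod of_int q)}"

definition char_quasi_polynomial ::
    "'a::euclidean_space set \<Rightarrow> (nat \<Rightarrow> 'a) \<Rightarrow> int \<Rightarrow> int \<Rightarrow> int \<Rightarrow> real" where
  "char_quasi_polynomial \<Phi> \<alpha> a b =
     (THE g. quasi_polynomial g \<and>
        eventually (\<lambda>q. g q = real (complement_count \<Phi> \<alpha> a b q)) at_top)"

definition fundamental_alcove :: "(nat \<Rightarrow> 'a::euclidean_space) \<Rightarrow> 'a \<Rightarrow> 'a set" where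
  "fundamental_alcove \<alpha> \<theta> = {x. (\<forall>i\<in>{1..DIM('a)}. \<alpha> i \<bullet> x > 0) \<and> \<theta> \<bullet> x < 1}"

definition alcove_ehrhart :: "(nat \<Rightarrow> 'a::euclidean_space) \<Rightarrow> 'a \<Rightarrow> int \<Rightarrow> real" where
  "alcove_ehrhart \<alpha> \<theta> =
     (THE g. quasi_polynomial g \<and>
        (\<forall>q>0. g q = real (card ((*\<^sub>R) (of_int q) ` closure (fundamental_alcove \<alpha> \<theta>)
                                 \<inter> coweight_lattice \<alpha>))))"

section \<open>Generalized Eulerian polynomial and shift operator\<close>

definition asc ::
    "'a::euclidean_space set \<Rightarrow> (nat \<Rightarrow> 'a) \<Rightarrow> (nat \<Rightarrow> nat) \<Rightarrow> ('a \<Rightarrow> 'a) \<Rightarrow> nat" where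
  "asc \<Phi> \<alpha> c w = (\<Sum>i \<in> {i \<in> {0..DIM('a)}. w (\<alpha> i) \<in> positive_roots \<Phi> \<alpha>}. c i)"

definition eulerian_poly ::
    "'a::euclidean_space set \<Rightarrow> (nat \<Rightarrow> 'a) \<Rightarrow> (nat \<Rightarrow> nat) \<Rightarrow> real poly" where
  "eulerian_poly \<Phi> \<alpha> c =
     smult (1 / real (lattice_index \<Phi> \<alpha>)) (\<Sum>w\<in>weyl_group \<Phi>. monom 1 (asc \<Phi> \<alpha> c w))"

definition shift :: "(int \<Rightarrow> real) \<Rightarrow> int \<Rightarrow> real" where
  "shift g = (\<lambda>t. g (t - 1))"

text \<open>\<open>poly_op p T g\<close> is \<open>p(T) g\<close>, for an operator \<open>T\<close> on functions.\<close>

definition poly_op ::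
    "real poly \<Rightarrow> ((int \<Rightarrow> real) \<Rightarrow> int \<Rightarrow> real) \<Rightarrow> (int \<Rightarrow> real) \<Rightarrow> int \<Rightarrow> real" where
  "poly_op p T g = (\<lambda>t. \<Sum>i\<le>degree p. coeff p i * (T ^^ i) g t)"

end

theory Submission
  imports Defs
begin

text \<open>
  Displacing a coweight by \<open>- \<rho> / h\<close>, with \<open>h\<close> the Coxeter number, moves it off every
  hyperplane \<open>\<beta> \<bullet> x = k\<close>. The affine Weyl group acts simply transitively on the alcoves, so
  modulo \<open>q\<close> times the coroot lattice every coweight is a point of exactly one partially closed
  dilated alcove \<open>w (q A)\<close>, \<open>w\<close> in the Weyl group (Worpitzky's partition). In terms of the
  distances \<open>y\<^sub>0, \<dots>, y\<^sub>l\<close> to the walls, this cell consists of the solutions in natural numbers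
  of \<open>\<Sum> c\<^sub>i y\<^sub>i = q\<close> with \<open>y\<^sub>i \<ge> 1\<close> whenever \<open>w \<alpha>\<^sub>i > 0\<close>. Every affine root is a combination of
  the walls with integral coefficients of one sign; hence a point of the cell avoids the
  arrangement modulo \<open>q\<close> if and only if \<open>y\<^sub>i \<ge> n + 1\<close> whenever \<open>w \<alpha>\<^sub>i > 0\<close>. Substituting
  \<open>y\<^sub>i - (n + 1)\<close> for those \<open>y\<^sub>i\<close> turns the number of such points into the value of the Ehrhart
  quasi-polynomial at \<open>q - (n + 1) asc w\<close>.
\<close>

section \<open>Quasi-polynomials and denumerants\<close>

text \<open>The displacement by \<open>\<rho> / h\<close> works because the height
  \<open>\<beta> \<bullet> \<rho>\<close> of a root is a nonzero integer of absolute value less than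
  \<open>h\<close>. So \<open>\<beta> \<bullet> \<rho> / h\<close> is never an integer, and its
  floor is 0 for positive and -1 for negative roots. Inside an alcove the displaced point satisfies
  a strict inequality \<open>w \<alpha>\<^sub>i \<bullet> \<rho> / h < y\<^sub>i\<close>; as
  \<open>y\<^sub>i\<close> is an integer, this reads \<open>y\<^sub>i \<ge> 1\<close> or
  \<open>y\<^sub>i \<ge> 0\<close> according to the sign of \<open>w \<alpha>\<^sub>i\<close>.

  Two lattices compete: cells are unique modulo \<open>q\<close> times the coroots, while the
  arrangement is counted modulo \<open>q\<close> times the coweights. A class of the latter kind is
  covered or uncovered as a whole, and an uncovered one meets the cells in \<open>f\<close> points,
  the index of the coroots in the coweights. This is the origin of the factor \<open>1 / f\<close>.

  The counting is done only for \<open>q\<close> so large that every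
  \<open>q - (n + 1) asc w\<close> is nonnegative, where the Ehrhart quasi-polynomial really counts
  solutions. Both sides are quasi-polynomials in \<open>q\<close>, so agreement for large
  \<open>q\<close> gives it everywhere.\<close>

lemma ex_poly_diff_monom:
  fixes d :: real
  assumes "d \<noteq> 0"
  shows "\<exists>F. \<forall>x. poly F (x + d) - poly F x = x ^ n"
proof (induction n rule: less_induct)
  case (less n)
  then obtain F where F: "\<And>k x. k < n \<Longrightarrow> poly (F k) (x + d) - poly (F k) x = x ^ k"
    by metis
  define C where "C = (\<lambda>k. real (Suc n choose k) * d ^ (Suc n - k))"
  \<comment> \<open>The leading term of \<open>(x + d) ^ Suc n - x ^ Suc n\<close> is
    \<open>Suc n * d * x ^ n\<close>; the lower powers are differences by the induction hypothesis
    and are subtracted off.\<close>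
  define G where "G = smult (1 / (real (Suc n) * d)) (monom 1 (Suc n) - (\<Sum>k<n. smult (C k) (F k)))"
  have "poly G (x + d) - poly G x = x ^ n" for x
  proof -
    have "(x + d) ^ Suc n = (\<Sum>k\<le>Suc n. C k * x ^ k)"
      unfolding binomial_ring C_def by (simp only: mult_ac)
    also have "\<dots> = (\<Sum>k<n. C k * x ^ k) + C n * x ^ n + x ^ Suc n"
      by (simp add: C_def lessThan_Suc_atMost[symmetric])
    finally have *: "(x + d) ^ Suc n - x ^ Suc n = (\<Sum>k<n. C k * x ^ k) + real (Suc n) * d * x ^ n"
      by (simp add: C_def algebra_simps)
    have "(\<Sum>k<n. C k * poly (F k) (x + d)) - (\<Sum>k<n. C k * poly (F k) x) = (\<Sum>k<n. C k * x ^ k)"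
      unfolding sum_subtractf[symmetric] right_diff_distrib[symmetric]
      by (intro sum.cong) (simp_all add: F)
    moreover have "poly G (x + d) - poly G x = ((x + d) ^ Suc n - x ^ Suc n
       - ((\<Sum>k<n. C k * poly (F k) (x + d)) - (\<Sum>k<n. C k * poly (F k) x))) / (real (Suc n) * d)"
      unfolding G_def poly_smult poly_diff poly_monom poly_sum
      by (simp add: algebra_simps diff_divide_distrib add_divide_distrib)
    ultimately show ?thesis using * assms by simp
  qed
  then show ?case by blast
qed

lemma ex_poly_diff:
  fixes d :: real
  assumes "d \<noteq> 0"
  shows "\<exists>F. \<forall>x. poly F (x + d) - poly F x = poly p x"
proof -
  obtain F where F: "\<And>n x. poly (F n) (x + d) - poly (F n) x = x ^ n"
    using ex_poly_diff_monom[OF assms] by metis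
  have "poly (\<Sum>i\<le>degree p. smult (coeff p i) (F i)) (x + d)
      - poly (\<Sum>i\<le>degree p. smult (coeff p i) (F i)) x = poly p x" for x
    by (simp add: poly_sum poly_altdef[of p] F
        sum_subtractf[symmetric] right_diff_distrib[symmetric])
  then show ?thesis by blast
qed

text \<open>
  Summing the recurrence over a common period \<open>r\<close> turns it into a first-order polynomial
  difference equation on every residue class modulo \<open>r\<close>.
\<close>

lemma quasi_polynomial_recurrence:
  fixes u :: "int \<Rightarrow> real" and c :: int
  assumes "quasi_polynomial g" and c: "c \<ge> 1"
    and rec: "\<And>m. m \<ge> c \<Longrightarrow> u m = u (m - c) + g m"
  shows "\<exists>G. quasi_polynomial G \<and> (\<forall>m\<ge>0. u m = G m)"
proof -
  obtain s p where s: "s > 0" and p: "\<And>q. g q = poly (p (q mod s)) (of_int q)"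
    using assms(1) unfolding quasi_polynomial_def by blast
  \<comment> \<open>A shift by \<open>r\<close> consists of \<open>s\<close> steps of the recurrence
    and preserves residues modulo \<open>s\<close>.\<close>
  define r where "r = c * s"
  have r: "r > 0" using s c by (simp add: r_def)
  have tele: "u m = u (m - c * int k) + (\<Sum>j<k. g (m - c * int j))" if "m \<ge> c * int k" for k m
    using that
  proof (induction k)
    case (Suc k)
    have "m - c * int k \<ge> c" using Suc.prems by (simp add: algebra_simps)
    from rec[OF this] show ?case using Suc c by (simp add: algebra_simps)
  qed simp
  \<comment> \<open>For \<open>m\<close> in class \<open>a\<close>, \<open>D a\<close> collects the
    \<open>s\<close> increments between \<open>m\<close> and \<open>m + r\<close>; composing with
    \<open>x + (r - c * j)\<close> rewrites each of them as a polynomial in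
    \<open>m\<close>.\<close>
  define D where "D = (\<lambda>a. \<Sum>j<nat s. pcompose (p ((a - c * int j) mod s)) [: of_int (r - c * int j), 1 :])"
  have step: "u (m + r) = u m + poly (D (m mod r)) (of_int m)" if "m \<ge> 0" for m
  proof -
    have *: "(m + r - c * int j) mod s = ((m mod r) - c * int j) mod s" for j
    proof -
      have "(m mod r) mod s = m mod s" unfolding r_def by (simp add: mod_mod_cancel)
      moreover have "(m + r - c * int j) mod s = (m - c * int j) mod s"
        unfolding r_def by (metis add_diff_eq diff_add_eq mod_mult_self1 mult.commute)
      ultimately show ?thesis by (metis mod_diff_left_eq)
    qed
    have "u (m + r) = u m + (\<Sum>j<nat s. g (m + r - c * int j))"
      using tele[of "nat s" "m + r"] that s by (simp add: r_def)
    also have "(\<Sum>j<nat s. g (m + r - c * int j)) = poly (D (m mod r)) (of_int m)"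
      unfolding D_def poly_sum by (intro sum.cong) (simp_all add: p * poly_pcompose algebra_simps)
    finally show ?thesis .
  qed
  obtain F where F: "\<And>a x. poly (F a) (x + of_int r) - poly (F a) x = poly (D a) x"
  proof -
    have "\<forall>a. \<exists>F. \<forall>x. poly F (x + of_int r) - poly F x = poly (D a) x"
      using ex_poly_diff[of "of_int r"] r by simp
    from choice[OF this] show ?thesis using that by blast
  qed
  \<comment> \<open>The added constant matches \<open>u\<close> at the representative
    \<open>a\<close> in \<open>{0..<r}\<close>, where the induction along the class starts.\<close>
  define P where "P = (\<lambda>a. F a + [: u a - poly (F a) (of_int a) :])"
  define G where "G = (\<lambda>q. poly (P (q mod r)) (of_int q))"
  have on_class: "u (a + r * int t) = G (a + r * int t)" if a: "0 \<le> a" "a < r" for a t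
  proof (induction t)
    case 0
    then show ?case using a by (simp add: G_def P_def)
  next
    case (Suc t)
    let ?m = "a + r * int t"
    have "u (?m + r) = u ?m + poly (D a) (of_int ?m)"
      using step[of ?m] a r by simp
    also have "\<dots> = poly (P a) (of_int ?m + of_int r)"
      using Suc F[of a "of_int ?m"] a by (simp add: G_def P_def algebra_simps)
    also have "\<dots> = G (?m + r)"
    proof -
      have "(?m + r) mod r = a" using a by simp
      then show ?thesis unfolding G_def by (simp only: of_int_add)
    qed
    finally show ?case by (simp add: algebra_simps)
  qed
  have "u m = G m" if "m \<ge> 0" for m
    using on_class[of "m mod r" "nat (m div r)"] r that by (simp add: pos_imp_zdiv_nonneg_iff)
  moreover have "quasi_polynomial G"
    unfolding quasi_polynomial_def G_def using r by blast
  ultimately show ?thesis by blast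
qed

section \<open>Closure properties of quasi-polynomials\<close>

lemma quasi_polynomialI:
  assumes "r > 0" "\<And>q. g q = poly (p (q mod r)) (of_int q)"
  shows "quasi_polynomial g"
  using assms unfolding quasi_polynomial_def by blast

lemma quasi_polynomial_cmult:
  assumes "quasi_polynomial g"
  shows "quasi_polynomial (\<lambda>q. a * g q)"
proof -
  obtain r p where "r > 0" "\<And>q. g q = poly (p (q mod r)) (of_int q)"
    using assms unfolding quasi_polynomial_def by blast
  then show ?thesis
    by (intro quasi_polynomialI[where r = r and p = "\<lambda>s. smult a (p s)"]) auto
qed

lemma quasi_polynomial_translate:
  assumes "quasi_polynomial g"
  shows "quasi_polynomial (\<lambda>q. g (q - a))"
proof -
  obtain r p where r: "r > 0" and p: "\<And>q. g q = poly (p (q mod r)) (of_int q)"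
    using assms unfolding quasi_polynomial_def by blast
  show ?thesis
    by (rule quasi_polynomialI[OF r, where p = "\<lambda>s. pcompose (p ((s - a) mod r)) [: - of_int a, 1 :]"])
      (simp add: p poly_pcompose mod_diff_left_eq)
qed

lemma quasi_polynomial_add:
  assumes "quasi_polynomial g" "quasi_polynomial h"
  shows "quasi_polynomial (\<lambda>q. g q + h q)"
proof -
  obtain r p where r: "r > 0" and p: "\<And>q. g q = poly (p (q mod r)) (of_int q)"
    using assms(1) unfolding quasi_polynomial_def by blast
  obtain s p' where s: "s > 0" and p': "\<And>q. h q = poly (p' (q mod s)) (of_int q)"
    using assms(2) unfolding quasi_polynomial_def by blast
  have rs: "r * s > 0" using r s by simp
  show ?thesis
    by (rule quasi_polynomialI[OF rs, where p = "\<lambda>t. p (t mod r) + p' (t mod s)"])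
      (simp add: p p' mod_mod_cancel)
qed

lemma quasi_polynomial_const: "quasi_polynomial (\<lambda>q. a)"
  unfolding quasi_polynomial_def by (intro exI[of _ 1] conjI exI[of _ "\<lambda>_. [:a:]"]) auto

lemma quasi_polynomial_sum:
  "(\<And>x. x \<in> A \<Longrightarrow> quasi_polynomial (g x)) \<Longrightarrow> quasi_polynomial (\<lambda>q. \<Sum>x\<in>A. g x q)"
  by (induction A rule: infinite_finite_induct)
    (auto intro: quasi_polynomial_const quasi_polynomial_add)

section \<open>Denumerants\<close>

definition solutions :: "(nat \<Rightarrow> nat) \<Rightarrow> nat \<Rightarrow> int \<Rightarrow> (nat \<Rightarrow> nat) set" where
  "solutions c k m = {y. (\<forall>i>k. y i = 0) \<and> int (\<Sum>i\<le>k. c i * y i) = m}"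

lemma finite_solutions:
  assumes "\<And>i. i \<le> k \<Longrightarrow> c i > 0"
  shows "finite (solutions c k m)"
proof (rule finite_subset)
  show "finite {y. \<forall>i. (i \<in> {..k} \<longrightarrow> y i \<in> {..nat m}) \<and> (i \<notin> {..k} \<longrightarrow> y i = 0)}"
    by (intro finite_set_of_finite_funs) auto
  have "y i \<le> nat m" if y: "y \<in> solutions c k m" and i: "i \<le> k" for y i
  proof -
    have "y i \<le> c i * y i" using assms[OF i] by simp
    also have "\<dots> \<le> (\<Sum>i\<le>k. c i * y i)" using i by (intro member_le_sum) auto
    also have "\<dots> = nat m" using y unfolding solutions_def by (metis (mono_tags) mem_Collect_eq nat_int)
    finally show ?thesis .
  qed
  then show "solutions c k m \<subseteq> {y. \<forall>i. (i \<in> {..k} \<longrightarrow> y i \<in> {..nat m}) \<and> (i \<notin> {..k} \<longrightarrow> y i = 0)}"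
    by (auto simp: solutions_def)
qed

text \<open>Either the last variable is 0, or it can be lowered by one. Since \<open>m\<close> is an
  integer and a negative \<open>m\<close> has no solutions, the identity holds without a lower bound
  on \<open>m\<close>.\<close>

lemma card_solutions_Suc:
  assumes "\<And>i. i \<le> Suc k \<Longrightarrow> c i > 0"
  shows "card (solutions c (Suc k) m) =
    card (solutions c (Suc k) (m - int (c (Suc k)))) + card (solutions c k m)"
proof -
  let ?f = "\<lambda>y :: nat \<Rightarrow> nat. y(Suc k := Suc (y (Suc k)))"
  have "solutions c (Suc k) m = ?f ` solutions c (Suc k) (m - int (c (Suc k))) \<union> solutions c k m"
  proof (intro equalityI subsetI)
    fix y assume y: "y \<in> solutions c (Suc k) m"
    show "y \<in> ?f ` solutions c (Suc k) (m - int (c (Suc k))) \<union> solutions c k m"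
    proof (cases "y (Suc k)")
      case 0
      then have "\<forall>i>k. y i = 0" using y by (auto simp: solutions_def) (metis Suc_lessI)
      then show ?thesis using y 0 by (simp add: solutions_def)
    next
      case (Suc a)
      then have "y(Suc k := a) \<in> solutions c (Suc k) (m - int (c (Suc k)))"
        using y by (auto simp: solutions_def algebra_simps)
      moreover have "y = ?f (y(Suc k := a))" using Suc by auto
      ultimately show ?thesis by blast
    qed
  next
    fix y assume "y \<in> ?f ` solutions c (Suc k) (m - int (c (Suc k))) \<union> solutions c k m"
    then show "y \<in> solutions c (Suc k) m"
      by (auto simp: solutions_def algebra_simps)
  qed
  moreover have "?f ` solutions c (Suc k) (m - int (c (Suc k))) \<inter> solutions c k m = {}"
    by (auto simp: solutions_def)
  moreover have "inj ?f"
    by (rule injI) (metis fun_upd_eqD fun_upd_triv fun_upd_upd nat.inject)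
  ultimately show ?thesis
    by (simp add: card_Un_disjoint finite_solutions assms card_image inj_on_subset)
qed

text \<open>Induction on the number of variables: each new one contributes a recurrence with step
  \<open>c (Suc k)\<close>. Because \<open>c 0 = 1\<close>, the base case has exactly one solution
  for each \<open>m \<ge> 0\<close>.\<close>

lemma denumerant_quasi_polynomial:
  assumes "\<And>i. i \<le> k \<Longrightarrow> c i > 0" and "c 0 = 1"
  shows "\<exists>G. quasi_polynomial G \<and> (\<forall>m\<ge>0. real (card (solutions c k m)) = G m)"
  using assms
proof (induction k)
  case 0
  have "solutions c 0 m = {(\<lambda>i. if i = 0 then nat m else 0)}" if "m \<ge> 0" for m
    using 0 that by (auto simp: solutions_def)
  then show ?case using quasi_polynomial_const[of 1] by (intro exI[of _ "\<lambda>_. 1"]) auto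
next
  case (Suc k)
  then obtain g where g: "quasi_polynomial g" "\<And>m. m \<ge> 0 \<Longrightarrow> real (card (solutions c k m)) = g m"
    by (metis le_SucI)
  show ?case
  proof (rule quasi_polynomial_recurrence[OF g(1)])
    show "int (c (Suc k)) \<ge> 1" using Suc.prems(1)[of "Suc k"] by simp
    show "real (card (solutions c (Suc k) m)) =
        real (card (solutions c (Suc k) (m - int (c (Suc k))))) + g m" if "m \<ge> int (c (Suc k))" for m
      using card_solutions_Suc[OF Suc.prems(1), where m = m] g(2)[of m] that by simp
  qed
qed

section \<open>The shift operator\<close>

lemma shift_power: "(shift ^^ i) g q = g (q - int i)"
  by (induction i arbitrary: q) (simp_all add: shift_def algebra_simps)

lemma poly_op_shift_monom_sum:
  assumes "finite A"
  shows "poly_op (smult a (\<Sum>w\<in>A. monom 1 (e w))) (shift ^^ k) g q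
    = a * (\<Sum>w\<in>A. g (q - int (k * e w)))"
proof -
  let ?p = "smult a (\<Sum>w\<in>A. monom 1 (e w))"
  have shift: "((shift ^^ k) ^^ i) g q = g (q - int (k * i))" for i
    by (simp add: funpow_mult shift_power)
  \<comment> \<open>A common bound for the degree and for all exponents \<open>e w\<close>, so that
    both sums can run over one fixed range and be interchanged.\<close>
  define N where "N = degree ?p + (\<Sum>w\<in>A. e w)"
  have "poly_op ?p (shift ^^ k) g q = (\<Sum>i\<le>N. coeff ?p i * g (q - int (k * i)))"
    unfolding poly_op_def shift by (intro sum.mono_neutral_left) (auto simp: N_def coeff_eq_0)
  also have "\<dots> = (\<Sum>i\<le>N. \<Sum>w\<in>A. a * (if e w = i then g (q - int (k * i)) else 0))"
    by (intro sum.cong) (auto simp: coeff_sum sum_distrib_left sum_distrib_right intro!: sum.cong)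
  also have "\<dots> = (\<Sum>w\<in>A. \<Sum>i\<le>N. a * (if e w = i then g (q - int (k * i)) else 0))"
    by (rule sum.swap)
  also have "\<dots> = (\<Sum>w\<in>A. a * g (q - int (k * e w)))"
  proof (intro sum.cong refl)
    fix w assume "w \<in> A"
    then have "e w \<le> N" using member_le_sum[of w A e] assms by (simp add: N_def trans_le_add2)
    then show "(\<Sum>i\<le>N. a * (if e w = i then g (q - int (k * i)) else 0)) = a * g (q - int (k * e w))"
      by (simp add: sum_distrib_left[symmetric])
  qed
  finally show ?thesis by (simp add: sum_distrib_left)
qed

section \<open>Roots and heights\<close>

lemma reflection_scaleR: "reflection \<gamma> (s *\<^sub>R x) = s *\<^sub>R reflection \<gamma> x"
  by (simp add: reflection_def algebra_simps)

lemma reflection_add: "reflection \<gamma> (x + y) = reflection \<gamma> x + reflection \<gamma> y"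
  by (simp add: reflection_def algebra_simps add_divide_distrib)

lemma linear_reflection: "linear (reflection \<gamma>)"
  by (intro linearI reflection_add reflection_scaleR)

lemma reflection_reflection [simp]: "reflection \<gamma> (reflection \<gamma> x) = x"
  by (cases "\<gamma> = 0") (simp_all add: reflection_def algebra_simps)

lemma inner_reflection: "reflection \<gamma> x \<bullet> reflection \<gamma> y = x \<bullet> y"
  by (cases "\<gamma> = 0") (simp_all add: reflection_def algebra_simps inner_commute)

locale highest_root_system =
  fixes \<Phi> :: "'a::euclidean_space set" and \<alpha> :: "nat \<Rightarrow> 'a" and \<theta> :: 'a and c :: "nat \<Rightarrow> nat"
  assumes root_system: "root_system \<Phi>"
    and simple_roots: "simple_roots \<Phi> \<alpha>"
    and highest_root: "highest_root \<Phi> \<alpha> \<theta>"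
    and theta_eq: "\<theta> = (\<Sum>i=1..DIM('a). real (c i) *\<^sub>R \<alpha> i)"
    and alpha_0: "\<alpha> 0 = - \<theta>"
    and c_0: "c 0 = 1"
begin

abbreviation pos_roots :: "'a set" where "pos_roots \<equiv> positive_roots \<Phi> \<alpha>"
abbreviation coweights :: "'a set" where "coweights \<equiv> coweight_lattice \<alpha>"
abbreviation coroots :: "'a set" where "coroots \<equiv> coroot_lattice \<Phi>"

lemma finite_roots: "finite \<Phi>" and zero_not_root: "0 \<notin> \<Phi>"
  and reflection_root: "\<beta> \<in> \<Phi> \<Longrightarrow> \<gamma> \<in> \<Phi> \<Longrightarrow> reflection \<beta> \<gamma> \<in> \<Phi>"
  and cartan_Ints: "\<beta> \<in> \<Phi> \<Longrightarrow> \<gamma> \<in> \<Phi> \<Longrightarrow> 2 * (\<beta> \<bullet> \<gamma>) / (\<beta> \<bullet> \<beta>) \<in> \<int>"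
  and reduced: "\<beta> \<in> \<Phi> \<Longrightarrow> s *\<^sub>R \<beta> \<in> \<Phi> \<Longrightarrow> s = 1 \<or> s = -1"
  and span_roots: "span \<Phi> = UNIV"
  using root_system unfolding root_system_def by auto

lemma uminus_root: "\<beta> \<in> \<Phi> \<Longrightarrow> - \<beta> \<in> \<Phi>"
  using reflection_root[of \<beta> \<beta>] zero_not_root by (cases "\<beta> = 0") (auto simp: reflection_def scaleR_2)

lemma alpha_root: "i \<le> DIM('a) \<Longrightarrow> \<alpha> i \<in> \<Phi>"
proof (cases "i = 0")
  case True
  then show ?thesis using highest_root uminus_root by (simp add: highest_root_def alpha_0)
next
  case False
  moreover assume "i \<le> DIM('a)"
  ultimately show ?thesis using simple_roots by (auto simp: simple_roots_def)
qed

section \<open>Coordinates with respect to the simple roots\<close>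

lemma simple_roots_ext:
  assumes "\<And>i. i \<in> {1..DIM('a)} \<Longrightarrow> \<alpha> i \<bullet> x = \<alpha> i \<bullet> y"
  shows "x = y"
proof -
  let ?B = "\<alpha> ` {1..DIM('a)}"
  have "card ?B = DIM('a)" using simple_roots by (simp add: simple_roots_def card_image)
  then have "UNIV \<subseteq> span ?B"
    using simple_roots by (intro card_ge_dim_independent) (auto simp: simple_roots_def)
  then have "x - y \<in> span ?B" by blast
  moreover have "orthogonal (x - y) a" if "a \<in> ?B" for a
    using that assms by (auto simp: orthogonal_def inner_diff_left inner_diff_right inner_commute)
  ultimately have "orthogonal (x - y) (x - y)" by (rule orthogonal_to_span)
  then show ?thesis by (simp add: orthogonal_def)
qed

text \<open>A linear functional can be prescribed on the independent simple roots and is the inner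
  product with some vector. The vectors obtained are the fundamental coweights.\<close>

lemma ex_dual_basis:
  "\<exists>\<omega>. \<forall>i\<in>{1..DIM('a)}. \<forall>j\<in>{1..DIM('a)}. \<alpha> j \<bullet> \<omega> i = (if i = j then 1 else 0)"
proof -
  have "\<exists>w. \<forall>j\<in>{1..DIM('a)}. \<alpha> j \<bullet> w = (if i = j then 1 else 0)" if i: "i \<in> {1..DIM('a)}" for i
  proof -
    have ind: "independent (\<alpha> ` {1..DIM('a)})" and inj: "inj_on \<alpha> {1..DIM('a)}"
      using simple_roots by (auto simp: simple_roots_def)
    from linear_independent_extend[OF ind, of "\<lambda>b. if b = \<alpha> i then 1 else 0 :: real"]
    obtain f where f: "linear f" "\<And>b. b \<in> \<alpha> ` {1..DIM('a)} \<Longrightarrow> f b = (if b = \<alpha> i then 1 else 0 :: real)"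
      by blast
    have *: "\<alpha> j \<bullet> (\<Sum>b\<in>Basis. f b *\<^sub>R b) = f (\<alpha> j)" for j
    proof -
      have "f (\<alpha> j) = f (\<Sum>b\<in>Basis. (\<alpha> j \<bullet> b) *\<^sub>R b)" by (simp add: euclidean_representation)
      also have "\<dots> = (\<Sum>b\<in>Basis. (\<alpha> j \<bullet> b) * f b)"
        using f(1) by (simp add: linear_sum linear_scale)
      finally show ?thesis by (simp add: inner_sum_right mult.commute)
    qed
    have "\<alpha> j \<bullet> (\<Sum>b\<in>Basis. f b *\<^sub>R b) = (if i = j then 1 else 0)" if "j \<in> {1..DIM('a)}" for j
      unfolding * using f(2)[of "\<alpha> j"] that inj_on_eq_iff[OF inj that i] by auto
    then show ?thesis by blast
  qed
  then show ?thesis by (intro bchoice) blast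
qed

definition \<omega> :: "nat \<Rightarrow> 'a" where
  "\<omega> = (SOME w. \<forall>i\<in>{1..DIM('a)}. \<forall>j\<in>{1..DIM('a)}. \<alpha> j \<bullet> w i = (if i = j then 1 else 0))"

lemma alpha_omega:
  "i \<in> {1..DIM('a)} \<Longrightarrow> j \<in> {1..DIM('a)} \<Longrightarrow> \<alpha> j \<bullet> \<omega> i = (if i = j then 1 else 0)"
  using someI_ex[OF ex_dual_basis] unfolding \<omega>_def by blast

lemma sum_alpha_omega:
  "j \<in> {1..DIM('a)} \<Longrightarrow> (\<Sum>i=1..DIM('a). s i *\<^sub>R \<alpha> i) \<bullet> \<omega> j = s j"
  by (simp add: inner_sum_left alpha_omega if_distrib cong: if_cong)

lemma theta_inner: "\<theta> \<bullet> x = (\<Sum>i=1..DIM('a). real (c i) * (\<alpha> i \<bullet> x))"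
  by (subst theta_eq) (simp add: inner_sum_left)

lemma atMost_DIM: "{..DIM('a)} = insert 0 {1..DIM('a)}"
  by auto

text \<open>This is the relation \<open>\<Sum> c\<^sub>i \<alpha>\<^sub>i = 0\<close> among the
  roots with index 0 included. The parameter \<open>t\<close> lets it serve both the alcove
  (\<open>t = 1\<close>) and its dilation (\<open>t = q\<close>).\<close>

lemma sum_affine_simple:
  "(\<Sum>i\<le>DIM('a). real (c i) * (\<alpha> i \<bullet> x + (if i = 0 then t else 0))) = t"
  unfolding atMost_DIM by (simp add: alpha_0 c_0 theta_inner)

text \<open>The values for \<open>i \<ge> 1\<close> can be chosen freely by means of the dual basis,
  and the relation then forces the value for \<open>i = 0\<close>, since \<open>c 0 = 1\<close>. The
  wall functions thus act as barycentric coordinates.\<close>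

lemma ex_simple_values:
  assumes "(\<Sum>i\<le>DIM('a). real (c i) * y i) = t"
  shows "\<exists>x. \<forall>i\<le>DIM('a). \<alpha> i \<bullet> x + (if i = 0 then t else 0) = y i"
proof -
  define x where "x = (\<Sum>j=1..DIM('a). y j *\<^sub>R \<omega> j)"
  have x: "\<alpha> i \<bullet> x = y i" if "i \<in> {1..DIM('a)}" for i
    using that by (simp add: x_def inner_sum_right alpha_omega if_distrib cong: if_cong)
  have "t = y 0 + \<theta> \<bullet> x"
    using assms unfolding atMost_DIM theta_inner by (simp add: x c_0)
  then have "\<alpha> i \<bullet> x + (if i = 0 then t else 0) = y i" if "i \<le> DIM('a)" for i
    using x[of i] that by (cases "i = 0") (auto simp: alpha_0)
  then show ?thesis by blast
qed

lemma pos_root_coeffs: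
  assumes "\<beta> \<in> pos_roots"
  obtains r :: "nat \<Rightarrow> nat" where "\<beta> = (\<Sum>i=1..DIM('a). real (r i) *\<^sub>R \<alpha> i)"
  using assms unfolding positive_roots_def simple_cone_def by auto

lemma highest_root_coeffs:
  assumes "\<beta> \<in> \<Phi>"
  obtains r :: "nat \<Rightarrow> nat" where "\<theta> - \<beta> = (\<Sum>i=1..DIM('a). real (r i) *\<^sub>R \<alpha> i)"
  using assms highest_root unfolding highest_root_def simple_cone_def by auto

text \<open>The difference of \<open>\<theta>\<close> and a simple root lies in the simple cone, so
  \<open>\<theta>\<close> contains each simple root at least once.\<close>

lemma c_pos: "i \<le> DIM('a) \<Longrightarrow> c i > 0"
proof (cases "i = 0")
  case False
  assume "i \<le> DIM('a)"
  then have i: "i \<in> {1..DIM('a)}" using False by auto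
  obtain r :: "nat \<Rightarrow> nat" where r: "\<theta> - \<alpha> i = (\<Sum>i=1..DIM('a). real (r i) *\<^sub>R \<alpha> i)"
    using i by (auto intro: highest_root_coeffs[OF alpha_root])
  have "(\<theta> - \<alpha> i) \<bullet> \<omega> i = real (r i)" unfolding r by (rule sum_alpha_omega[OF i])
  moreover have "\<theta> \<bullet> \<omega> i = real (c i)" by (subst theta_eq) (rule sum_alpha_omega[OF i])
  ultimately show ?thesis using alpha_omega[OF i i] by (simp add: inner_diff_left)
qed (simp add: c_0)

lemma sum_alpha_0:
  "(\<Sum>i\<le>DIM('a). s i *\<^sub>R \<alpha> i) = (\<Sum>i=1..DIM('a). s i *\<^sub>R \<alpha> i) - s 0 *\<^sub>R \<theta>"
  unfolding atMost_DIM by (simp add: alpha_0)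

text \<open>
  The pair \<open>(\<beta>, k)\<close> stands for the affine function \<open>\<lambda>x. \<beta> \<bullet> x + k\<close>, which is expanded here
  in the functions vanishing on the walls of the alcove; the constant term is the coefficient
  of \<open>1 - \<theta> \<bullet> x\<close>.
\<close>

lemma affine_root_coeffs:
  fixes k :: int
  assumes "\<beta> \<in> \<Phi>"
  obtains m :: "nat \<Rightarrow> int" where "\<beta> = (\<Sum>i\<le>DIM('a). of_int (m i) *\<^sub>R \<alpha> i)" "m 0 = k"
    "(\<forall>i\<le>DIM('a). m i \<ge> 0) \<or> (\<forall>i\<le>DIM('a). m i \<le> 0)"
proof -
  have pos: "\<exists>m :: nat \<Rightarrow> int. \<beta> = (\<Sum>i\<le>DIM('a). of_int (m i) *\<^sub>R \<alpha> i) \<and> m 0 = k \<and> (\<forall>i\<le>DIM('a). m i \<ge> 0)"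
    if \<beta>: "\<beta> \<in> \<Phi>" and k: "k > 0 \<or> k = 0 \<and> \<beta> \<in> pos_roots" for \<beta> and k :: int
    using k
  proof (elim disjE conjE)
    assume k: "k > 0"
    obtain r :: "nat \<Rightarrow> nat" where r: "\<theta> - (- \<beta>) = (\<Sum>i=1..DIM('a). real (r i) *\<^sub>R \<alpha> i)"
      by (rule highest_root_coeffs[OF uminus_root[OF \<beta>]])
    \<comment> \<open>As functions, \<open>\<beta> + k = (\<theta> + \<beta>) + (k - 1) \<theta> + k
      (1 - \<theta>)\<close>. The first summand lies in the simple cone because
      \<open>- \<beta>\<close> is a root below \<open>\<theta>\<close>, and \<open>k \<ge> 1\<close>
      makes the others nonnegative.\<close>
    define m where "m = (\<lambda>i. if i = 0 then k else int (r i) + (k - 1) * int (c i))"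
    have "(\<Sum>i=1..DIM('a). of_int (m i) *\<^sub>R \<alpha> i)
        = (\<Sum>i=1..DIM('a). real (r i) *\<^sub>R \<alpha> i + of_int (k - 1) *\<^sub>R (real (c i) *\<^sub>R \<alpha> i))"
      by (intro sum.cong) (auto simp: m_def algebra_simps)
    also have "\<dots> = \<theta> + \<beta> + of_int (k - 1) *\<^sub>R \<theta>"
      unfolding sum.distrib r[symmetric] scaleR_sum_right[symmetric] theta_eq[symmetric] by simp
    finally have "\<beta> = (\<Sum>i\<le>DIM('a). of_int (m i) *\<^sub>R \<alpha> i)"
      unfolding sum_alpha_0 by (simp add: m_def algebra_simps)
    then show ?thesis using k by (intro exI[of _ m]) (auto simp: m_def)
  next
    assume k: "k = 0" and "\<beta> \<in> pos_roots"
    then obtain r :: "nat \<Rightarrow> nat" where r: "\<beta> = (\<Sum>i=1..DIM('a). real (r i) *\<^sub>R \<alpha> i)"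
      by (auto elim: pos_root_coeffs)
    then have "\<beta> = (\<Sum>i\<le>DIM('a). of_int ((if i = 0 then 0 else int (r i))) *\<^sub>R \<alpha> i)"
      unfolding sum_alpha_0 by simp
    then show ?thesis using k by (intro exI[of _ "\<lambda>i. if i = 0 then 0 else int (r i)"]) simp
  qed
  consider "k > 0 \<or> k = 0 \<and> \<beta> \<in> pos_roots" | "- k > 0 \<or> - k = 0 \<and> - \<beta> \<in> pos_roots"
    using simple_roots assms unfolding simple_roots_def by fastforce
  then show ?thesis
  proof cases
    case 1
    then show ?thesis using pos[OF assms] that by blast
  next
    case 2
    from pos[OF uminus_root[OF assms] this] obtain m :: "nat \<Rightarrow> int"
      where m: "- \<beta> = (\<Sum>i\<le>DIM('a). of_int (m i) *\<^sub>R \<alpha> i)" "m 0 = - k" "\<forall>i\<le>DIM('a). m i \<ge> 0"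
      by blast
    have "\<beta> = - (\<Sum>i\<le>DIM('a). of_int (m i) *\<^sub>R \<alpha> i)" using m(1) by (metis minus_minus)
    also have "\<dots> = (\<Sum>i\<le>DIM('a). of_int (- m i) *\<^sub>R \<alpha> i)" by (simp add: sum_negf)
    finally show ?thesis using m that[of "\<lambda>i. - m i"] by simp
  qed
qed

lemma affine_coeffs_value:
  fixes k :: int
  assumes "\<beta> = (\<Sum>i\<le>DIM('a). of_int (m i) *\<^sub>R \<alpha> i)" "m 0 = k"
  shows "\<beta> \<bullet> x + of_int k * t = (\<Sum>i\<le>DIM('a). of_int (m i) * (\<alpha> i \<bullet> x + (if i = 0 then t else 0)))"
proof -
  have "\<beta> \<bullet> x = (\<Sum>i\<le>DIM('a). of_int (m i) * (\<alpha> i \<bullet> x))"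
    by (subst assms(1)) (simp add: inner_sum_left)
  then show ?thesis using assms(2) unfolding atMost_DIM
    by (simp add: distrib_left)
qed

section \<open>Coxeter number and heights of roots\<close>

definition cox :: real where "cox = (\<Sum>i\<le>DIM('a). real (c i))"
text \<open>Pairing with the sum of the fundamental coweights gives the height of a root. The point
  \<open>(1 / cox) *\<^sub>R \<rho>\<close> is the one where all walls take the same value,
  \<open>1 / cox\<close>.\<close>

definition \<rho> :: 'a where "\<rho> = (\<Sum>i=1..DIM('a). \<omega> i)"

lemma alpha_rho: "i \<in> {1..DIM('a)} \<Longrightarrow> \<alpha> i \<bullet> \<rho> = 1"
  by (simp add: \<rho>_def inner_sum_right alpha_omega)

lemma cox_eq: "cox = 1 + \<theta> \<bullet> \<rho>"
  unfolding cox_def atMost_DIM theta_inner by (simp add: alpha_rho c_0)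

lemma cox_gt_1: "cox > 1"
proof -
  have "(\<Sum>i=1..DIM('a). real (c i)) > 0"
    using c_pos by (intro sum_pos) auto
  then show ?thesis unfolding cox_eq theta_inner by (simp add: alpha_rho)
qed

lemma affine_simple_rho: "i \<le> DIM('a) \<Longrightarrow> \<alpha> i \<bullet> \<rho> + (if i = 0 then cox else 0) = 1"
  using alpha_rho[of i] by (cases "i = 0") (auto simp: cox_eq alpha_0)

text \<open>The height is a sum of natural coefficients that do not all vanish, and it is at most
  the height of \<open>\<theta>\<close>, which is \<open>cox - 1\<close>.\<close>

lemma pos_root_height:
  assumes "\<beta> \<in> pos_roots"
  shows "\<beta> \<bullet> \<rho> > 0" "\<beta> \<bullet> \<rho> < cox"
proof -
  obtain r :: "nat \<Rightarrow> nat" where r: "\<beta> = (\<Sum>i=1..DIM('a). real (r i) *\<^sub>R \<alpha> i)"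
    using assms by (rule pos_root_coeffs)
  have \<beta>: "\<beta> \<in> \<Phi>" using assms by (simp add: positive_roots_def)
  have "(\<Sum>i=1..DIM('a). real (r i)) \<noteq> 0"
  proof
    assume "(\<Sum>i=1..DIM('a). real (r i)) = 0"
    then have "\<forall>i\<in>{1..DIM('a)}. real (r i) = 0" by (subst (asm) sum_nonneg_eq_0_iff) auto
    then have "\<beta> = 0" using r by simp
    then show False using \<beta> zero_not_root by simp
  qed
  moreover have "(\<Sum>i=1..DIM('a). real (r i)) \<ge> 0" by (intro sum_nonneg) simp
  moreover have "\<beta> \<bullet> \<rho> = (\<Sum>i=1..DIM('a). real (r i))"
    by (subst r) (simp add: inner_sum_left alpha_rho)
  ultimately show "\<beta> \<bullet> \<rho> > 0" by simp
  obtain s :: "nat \<Rightarrow> nat" where s: "\<theta> - \<beta> = (\<Sum>i=1..DIM('a). real (s i) *\<^sub>R \<alpha> i)"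
    using \<beta> by (rule highest_root_coeffs)
  have "(\<theta> - \<beta>) \<bullet> \<rho> = (\<Sum>i=1..DIM('a). real (s i))"
    unfolding s by (simp add: inner_sum_left alpha_rho)
  moreover have "\<dots> \<ge> 0" by (intro sum_nonneg) simp
  ultimately show "\<beta> \<bullet> \<rho> < cox" by (simp add: cox_eq inner_diff_left)
qed

lemma pos_root_iff_height: "\<beta> \<in> \<Phi> \<Longrightarrow> \<beta> \<in> pos_roots \<longleftrightarrow> \<beta> \<bullet> \<rho> > 0"
  using pos_root_height(1)[of \<beta>] pos_root_height(1)[of "-\<beta>"] simple_roots
  unfolding simple_roots_def by fastforce

lemma neg_root: "\<beta> \<in> \<Phi> \<Longrightarrow> \<beta> \<notin> pos_roots \<Longrightarrow> - \<beta> \<in> pos_roots"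
  using simple_roots unfolding simple_roots_def by blast

text \<open>The floor records the sign of the root. The non-integrality is what keeps displaced
  coweights off every affine hyperplane.\<close>

lemma root_height_bounds:
  assumes "\<beta> \<in> \<Phi>"
  shows "\<lfloor>\<beta> \<bullet> \<rho> / cox\<rfloor> = (if \<beta> \<in> pos_roots then 0 else -1)" "\<beta> \<bullet> \<rho> / cox \<notin> \<int>"
proof -
  have *: "\<lfloor>\<beta> \<bullet> \<rho> / cox\<rfloor> = (if \<beta> \<in> pos_roots then 0 else -1) \<and> \<beta> \<bullet> \<rho> / cox \<noteq> of_int \<lfloor>\<beta> \<bullet> \<rho> / cox\<rfloor>"
  proof (cases "\<beta> \<in> pos_roots")
    case True
    then have "\<beta> \<bullet> \<rho> / cox > 0" "\<beta> \<bullet> \<rho> / cox < 1" using pos_root_height cox_gt_1 by simp_all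
    moreover from this have "\<lfloor>\<beta> \<bullet> \<rho> / cox\<rfloor> = 0" by (intro floor_unique) simp_all
    ultimately show ?thesis using True by auto
  next
    case False
    then have "- \<beta> \<in> pos_roots" using neg_root assms by blast
    then have "\<beta> \<bullet> \<rho> / cox < 0" "\<beta> \<bullet> \<rho> / cox > -1"
      using pos_root_height[of "- \<beta>"] cox_gt_1 by (simp_all add: divide_simps)
    moreover from this have "\<lfloor>\<beta> \<bullet> \<rho> / cox\<rfloor> = -1" by (intro floor_unique) simp_all
    ultimately show ?thesis using False by auto
  qed
  then show "\<lfloor>\<beta> \<bullet> \<rho> / cox\<rfloor> = (if \<beta> \<in> pos_roots then 0 else -1)" by blast
  show "\<beta> \<bullet> \<rho> / cox \<notin> \<int>"
    using * by (metis Ints_cases floor_of_int)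
qed

text \<open>It translates strict inequalities at displaced coweights into the integral bounds that
  define \<open>cell\<close>: a positive root asks for one unit more.\<close>

lemma height_less_iff:
  "\<beta> \<in> \<Phi> \<Longrightarrow> \<beta> \<bullet> \<rho> / cox < of_int y \<longleftrightarrow> (if \<beta> \<in> pos_roots then y \<ge> 1 else y \<ge> 0)"
  using root_height_bounds(1)[of \<beta>] by (auto simp: floor_less_iff[symmetric])

section \<open>The affine Weyl group\<close>

definition affine_value :: "'a \<times> int \<Rightarrow> 'a \<Rightarrow> real" where
  "affine_value p x = fst p \<bullet> x + of_int (snd p)"

definition affine_simple :: "nat \<Rightarrow> 'a \<times> int" where
  "affine_simple i = (\<alpha> i, if i = 0 then 1 else 0)"

definition affine_reflection :: "'a \<times> int \<Rightarrow> 'a \<Rightarrow> 'a" where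
  "affine_reflection p x = x - (2 * affine_value p x / (fst p \<bullet> fst p)) *\<^sub>R fst p"

text \<open>The quotient is an integer for roots, so there the floor only changes the type.\<close>

definition cartan :: "'a \<Rightarrow> 'a \<Rightarrow> int" where
  "cartan \<beta> \<gamma> = \<lfloor>2 * (\<beta> \<bullet> \<gamma>) / (\<beta> \<bullet> \<beta>)\<rfloor>"

text \<open>The pull-back of the affine function \<open>r\<close> along the reflection of
  \<open>p\<close> (see \<open>affine_value_reflection\<close>); Cartan integers keep its constant
  term integral.\<close>

definition act :: "'a \<times> int \<Rightarrow> 'a \<times> int \<Rightarrow> 'a \<times> int" where
  "act p r = (reflection (fst p) (fst r), snd r - cartan (fst p) (fst r) * snd p)"

text \<open>The fundamental alcove, with the condition on \<open>\<theta>\<close> turned into a wall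
  with index 0 so that all walls are treated alike.\<close>

abbreviation alcove :: "'a set" where
  "alcove \<equiv> {x. \<forall>i\<le>DIM('a). affine_value (affine_simple i) x > 0}"

abbreviation affine_roots :: "('a \<times> int) set" where
  "affine_roots \<equiv> \<Phi> \<times> UNIV"

lemma of_int_cartan:
  "\<beta> \<in> \<Phi> \<Longrightarrow> \<gamma> \<in> \<Phi> \<Longrightarrow> of_int (cartan \<beta> \<gamma>) = 2 * (\<beta> \<bullet> \<gamma>) / (\<beta> \<bullet> \<beta>)"
  using cartan_Ints unfolding cartan_def by (auto elim: Ints_cases)

lemma root_inner_pos: "\<beta> \<in> \<Phi> \<Longrightarrow> \<beta> \<bullet> \<beta> > 0"
  using zero_not_root by auto

lemma affine_simple_root: "i \<le> DIM('a) \<Longrightarrow> affine_simple i \<in> affine_roots"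
  using alpha_root by (simp add: affine_simple_def)

lemma act_root: "p \<in> affine_roots \<Longrightarrow> r \<in> affine_roots \<Longrightarrow> act p r \<in> affine_roots"
  using reflection_root by (auto simp: act_def)

lemma affine_value_act:
  assumes "p \<in> affine_roots" "r \<in> affine_roots"
  shows "affine_value (act p r) x = affine_value r x - of_int (cartan (fst p) (fst r)) * affine_value p x"
  using assms of_int_cartan[of "fst p" "fst r"]
  by (auto simp: act_def affine_value_def reflection_def inner_diff_left algebra_simps)

lemma affine_value_reflection:
  assumes "p \<in> affine_roots" "r \<in> affine_roots"
  shows "affine_value r (affine_reflection p x) = affine_value (act p r) x"
  unfolding affine_value_act[OF assms] using assms of_int_cartan[of "fst p" "fst r"]
  by (auto simp: affine_value_def affine_reflection_def inner_diff_right inner_commute)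

lemma affine_reflection_diff:
  "affine_reflection p (x - s *\<^sub>R y) = affine_reflection p x - s *\<^sub>R reflection (fst p) y"
  by (simp add: affine_reflection_def affine_value_def reflection_def algebra_simps
      add_divide_distrib diff_divide_distrib inner_diff_right)

lemma affine_reflection_eq:
  "affine_reflection p x = reflection (fst p) x - (2 * of_int (snd p) / (fst p \<bullet> fst p)) *\<^sub>R fst p"
  by (simp add: affine_reflection_def affine_value_def reflection_def algebra_simps add_divide_distrib)

lemma affine_reflection_involution:
  assumes "p \<in> affine_roots"
  shows "affine_reflection p (affine_reflection p x) = x"
proof -
  have "fst p \<bullet> fst p > 0" using assms root_inner_pos by auto
  then have "reflection (fst p) (fst p) = - fst p" by (simp add: reflection_def scaleR_2)
  then show ?thesis
    by (subst (2) affine_reflection_def) (simp add: affine_reflection_diff, simp add: affine_reflection_def)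
qed

lemma affine_value_reflection_self:
  "p \<in> affine_roots \<Longrightarrow> affine_value p (affine_reflection p x) = - affine_value p x"
  using root_inner_pos[of "fst p"]
  by (auto simp: affine_value_def affine_reflection_def inner_diff_right)

text \<open>The conjugation rule for reflections, used to carry a reflection through a word letter
  by letter. The linear part of the first reflection maps the direction of \<open>act p r\<close> to
  that of \<open>r\<close> and preserves its length.\<close>

lemma affine_reflection_conj:
  assumes "p \<in> affine_roots" "r \<in> affine_roots"
  shows "affine_reflection r (affine_reflection p x) = affine_reflection p (affine_reflection (act p r) x)"
proof -
  have "affine_reflection p (affine_reflection (act p r) x)
     = affine_reflection p x - (2 * affine_value (act p r) x / (fst r \<bullet> fst r)) *\<^sub>R fst r"
    unfolding affine_reflection_def[of "act p r"] affine_reflection_diff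
    by (simp add: act_def inner_reflection)
  then show ?thesis
    by (simp add: affine_reflection_def[of r] affine_value_reflection[OF assms])
qed

lemma affine_simple_value: "affine_value (affine_simple i) x = \<alpha> i \<bullet> x + (if i = 0 then 1 else 0)"
  by (simp add: affine_value_def affine_simple_def)

lemma affine_root_value:
  assumes "p \<in> affine_roots"
  obtains m :: "nat \<Rightarrow> int" where
    "fst p = (\<Sum>i\<le>DIM('a). of_int (m i) *\<^sub>R \<alpha> i)" "m 0 = snd p"
    "(\<forall>i\<le>DIM('a). m i \<ge> 0) \<or> (\<forall>i\<le>DIM('a). m i \<le> 0)"
    "\<And>x. affine_value p x = (\<Sum>i\<le>DIM('a). of_int (m i) * affine_value (affine_simple i) x)"
proof -
  obtain \<beta> k where p: "p = (\<beta>, k)" "\<beta> \<in> \<Phi>" using assms by auto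
  obtain m :: "nat \<Rightarrow> int" where m: "\<beta> = (\<Sum>i\<le>DIM('a). of_int (m i) *\<^sub>R \<alpha> i)" "m 0 = k"
    "(\<forall>i\<le>DIM('a). m i \<ge> 0) \<or> (\<forall>i\<le>DIM('a). m i \<le> 0)"
    using affine_root_coeffs[OF p(2)] by blast
  have "affine_value p x = (\<Sum>i\<le>DIM('a). of_int (m i) * affine_value (affine_simple i) x)" for x
  proof -
    have "affine_value p x = \<beta> \<bullet> x + of_int k * 1" by (simp add: p affine_value_def)
    then show ?thesis unfolding affine_coeffs_value[OF m(1,2)] affine_simple_value .
  qed
  with m p that show ?thesis by auto
qed

section \<open>Positive affine roots\<close>

definition positive :: "'a \<times> int \<Rightarrow> bool" where
  "positive p \<longleftrightarrow> p \<in> affine_roots \<and> (\<forall>x\<in>alcove. affine_value p x > 0)"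

lemma alcove_nonempty: "(1 / cox) *\<^sub>R \<rho> \<in> alcove"
  and affine_simple_center: "i \<le> DIM('a) \<Longrightarrow> affine_value (affine_simple i) ((1 / cox) *\<^sub>R \<rho>) = 1 / cox"
proof -
  show *: "affine_value (affine_simple i) ((1 / cox) *\<^sub>R \<rho>) = 1 / cox" if "i \<le> DIM('a)" for i
    using affine_simple_rho[OF that] cox_gt_1 by (auto simp: affine_simple_value field_simps split: if_splits)
  show "(1 / cox) *\<^sub>R \<rho> \<in> alcove" using * cox_gt_1 by simp
qed

text \<open>All coefficients have the same sign, so one point of the closed alcove decides. Boundary
  points must be allowed: \<open>positive_act_simple\<close> tests on a wall.\<close>

lemma positiveI:
  assumes p: "p \<in> affine_roots" and x: "\<And>i. i \<le> DIM('a) \<Longrightarrow> affine_value (affine_simple i) x \<ge> 0"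
    and pos: "affine_value p x > 0"
  shows "positive p"
proof -
  obtain m :: "nat \<Rightarrow> int" where sgn: "(\<forall>i\<le>DIM('a). m i \<ge> 0) \<or> (\<forall>i\<le>DIM('a). m i \<le> 0)"
    and m: "\<And>x. affine_value p x = (\<Sum>i\<le>DIM('a). of_int (m i) * affine_value (affine_simple i) x)"
    using affine_root_value[OF p] by metis
  have "\<exists>i\<le>DIM('a). m i > 0"
  proof (rule ccontr)
    assume "\<not> ?thesis"
    then have "affine_value p x \<le> 0"
      unfolding m using x by (intro sum_nonpos) (auto intro!: mult_nonpos_nonneg simp: not_less)
    then show False using pos by simp
  qed
  then obtain i where i: "i \<le> DIM('a)" "m i > 0" by blast
  with sgn have nn: "\<forall>i\<le>DIM('a). m i \<ge> 0" by force
  have "affine_value p y > 0" if "y \<in> alcove" for y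
    unfolding m using i nn that by (intro sum_pos2[of _ i]) (auto simp: less_imp_le)
  then show ?thesis using p by (simp add: positive_def)
qed

lemma affine_root_center:
  assumes "p \<in> affine_roots" shows "affine_value p ((1 / cox) *\<^sub>R \<rho>) \<noteq> 0"
proof
  assume "affine_value p ((1 / cox) *\<^sub>R \<rho>) = 0"
  then have "fst p \<bullet> \<rho> / cox = of_int (- snd p)" by (simp add: affine_value_def)
  then have "fst p \<bullet> \<rho> / cox \<in> \<int>" by (simp only: Ints_of_int)
  then show False using root_height_bounds(2)[of "fst p"] assms by auto
qed

lemma affine_value_uminus: "affine_value (- p) x = - affine_value p x"
  by (simp add: affine_value_def)

lemma uminus_affine_root: "p \<in> affine_roots \<Longrightarrow> - p \<in> affine_roots"
  using uminus_root by (cases p) auto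

lemma positive_cases:
  assumes "p \<in> affine_roots" shows "positive p \<or> positive (- p)"
proof (cases "affine_value p ((1 / cox) *\<^sub>R \<rho>) > 0")
  case True
  then show ?thesis using positiveI[OF assms] alcove_nonempty by (blast intro: less_imp_le)
next
  case False
  then have "affine_value (- p) ((1 / cox) *\<^sub>R \<rho>) > 0"
    using affine_root_center[OF assms] by (simp add: affine_value_uminus)
  then show ?thesis
    using positiveI[OF uminus_affine_root[OF assms]] alcove_nonempty by (blast intro: less_imp_le)
qed

lemma positive_affine_simple: "i \<le> DIM('a) \<Longrightarrow> positive (affine_simple i)"
  using affine_simple_root by (simp add: positive_def)

lemma positive_coeffs:
  assumes p: "positive p"
  obtains m :: "nat \<Rightarrow> int" where
    "fst p = (\<Sum>i\<le>DIM('a). of_int (m i) *\<^sub>R \<alpha> i)" "m 0 = snd p" "\<forall>i\<le>DIM('a). m i \<ge> 0"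
    "\<And>x. affine_value p x = (\<Sum>i\<le>DIM('a). of_int (m i) * affine_value (affine_simple i) x)"
proof -
  have p': "p \<in> affine_roots" using p by (simp add: positive_def)
  obtain m :: "nat \<Rightarrow> int" where f: "fst p = (\<Sum>j\<le>DIM('a). of_int (m j) *\<^sub>R \<alpha> j)" "m 0 = snd p"
    and sgn: "(\<forall>j\<le>DIM('a). m j \<ge> 0) \<or> (\<forall>j\<le>DIM('a). m j \<le> 0)"
    and m: "\<And>x. affine_value p x = (\<Sum>j\<le>DIM('a). of_int (m j) * affine_value (affine_simple j) x)"
    by (rule affine_root_value[OF p']) (rule that; assumption)
  have "\<forall>j\<le>DIM('a). m j \<ge> 0"
  proof (rule ccontr)
    assume "\<not> ?thesis"
    then have "affine_value p ((1 / cox) *\<^sub>R \<rho>) \<le> 0"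
      unfolding m using sgn cox_gt_1 by (intro sum_nonpos) (auto simp: affine_simple_center divide_simps)
    then show False using p alcove_nonempty by (force simp: positive_def)
  qed
  with f m that show ?thesis by blast
qed

text \<open>The simple reflection \<open>i\<close> sends only its own root to a negative one. By
  reducedness any other positive \<open>p\<close> has a positive coefficient at some wall
  \<open>j\<close> other than \<open>i\<close>. On wall \<open>i\<close> the root \<open>p\<close>
  and its image agree, and in the relative interior of that wall the term of \<open>j\<close> makes
  the value positive.\<close>

lemma positive_act_simple:
  assumes p: "positive p" and i: "i \<le> DIM('a)" and ne: "p \<noteq> affine_simple i"
  shows "positive (act (affine_simple i) p)"
proof -
  have p': "p \<in> affine_roots" using p by (simp add: positive_def)
  obtain m :: "nat \<Rightarrow> int" where f: "fst p = (\<Sum>j\<le>DIM('a). of_int (m j) *\<^sub>R \<alpha> j)" "m 0 = snd p"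
    and nn: "\<forall>j\<le>DIM('a). m j \<ge> 0"
    and m: "\<And>x. affine_value p x = (\<Sum>j\<le>DIM('a). of_int (m j) * affine_value (affine_simple j) x)"
    by (rule positive_coeffs[OF p]) (rule that; assumption)
  have "\<exists>j\<le>DIM('a). j \<noteq> i \<and> m j > 0"
  proof (rule ccontr)
    assume "\<not> ?thesis"
    with nn have z: "m j = 0" if "j \<le> DIM('a)" "j \<noteq> i" for j
      using that by (meson antisym not_le)
    then have "fst p = (\<Sum>j\<le>DIM('a). (if j = i then of_int (m i) *\<^sub>R \<alpha> i else 0))"
      unfolding f(1) by (intro sum.cong) auto
    then have fp: "fst p = of_int (m i) *\<^sub>R \<alpha> i" using i by simp
    then have "of_int (m i) *\<^sub>R \<alpha> i \<in> \<Phi>" using p' by auto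
    from reduced[OF alpha_root[OF i] this] have "real_of_int (m i) = 1 \<or> real_of_int (m i) = -1" .
    then have mi: "m i = 1" using nn i by fastforce
    then have "snd p = (if i = 0 then 1 else 0)" using z[of 0] f(2) by auto
    then have "p = affine_simple i" using fp mi by (simp add: affine_simple_def prod_eq_iff)
    then show False using ne by simp
  qed
  then obtain j where j: "j \<le> DIM('a)" "j \<noteq> i" "m j > 0" by blast
  \<comment> \<open>Value 0 on wall \<open>i\<close> and the common value \<open>1 / s\<close> on
    the others satisfy the relation required by \<open>ex_simple_values\<close>.\<close>
  define s where "s = (\<Sum>j\<in>{..DIM('a)} - {i}. real (c j))"
  have s: "s > 0" unfolding s_def using c_pos j by (intro sum_pos) auto
  have "(\<Sum>j\<le>DIM('a). real (c j) * (if j = i then 0 else 1 / s)) = (\<Sum>j\<in>{..DIM('a)} - {i}. real (c j) / s)"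
    by (rule sum.mono_neutral_cong_right) auto
  also have "\<dots> = 1" using s by (simp add: sum_divide_distrib[symmetric] s_def[symmetric])
  finally have "\<exists>x. \<forall>j\<le>DIM('a). \<alpha> j \<bullet> x + (if j = 0 then 1 else 0) = (if j = i then 0 else 1 / s)"
    by (rule ex_simple_values)
  \<comment> \<open>a point in the relative interior of the \<open>i\<close>-th wall of the alcove\<close>
  then obtain x where x: "\<And>j. j \<le> DIM('a) \<Longrightarrow> affine_value (affine_simple j) x = (if j = i then 0 else 1 / s)"
    unfolding affine_simple_value by blast
  have "affine_value (act (affine_simple i) p) x = affine_value p x"
    by (simp add: affine_value_act[OF affine_simple_root[OF i] p'] x[OF i])
  also have "affine_value p x > 0"
    unfolding m using j s nn by (intro sum_pos2[of _ j]) (auto simp: x less_imp_le)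
  finally show ?thesis
    using p' i s x by (intro positiveI[of _ x] act_root affine_simple_root) auto
qed

section \<open>Words in the simple reflections\<close>

abbreviation simple_reflection :: "nat \<Rightarrow> 'a \<Rightarrow> 'a" where
  "simple_reflection i \<equiv> affine_reflection (affine_simple i)"

definition word :: "nat list \<Rightarrow> 'a \<Rightarrow> 'a" where
  "word is = foldr (\<lambda>i f. simple_reflection i \<circ> f) is id"

lemma word_Nil [simp]: "word [] = id"
  and word_Cons [simp]: "word (i # is) x = simple_reflection i (word is x)"
  by (simp_all add: word_def)

lemma word_append: "word (is @ js) x = word is (word js x)"
  by (induction "is") auto

text \<open>The affine Weyl group, generated by the reflections in the walls of the alcove. It turns
  out to contain all affine reflections (\<open>affine_reflection_words\<close>) and to consist of
  Weyl group elements followed by coroot translations.\<close>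

definition words :: "('a \<Rightarrow> 'a) set" where
  "words = word ` lists {..DIM('a)}"

lemma words_comp:
  assumes "g \<in> words" "h \<in> words" shows "g \<circ> h \<in> words"
proof -
  obtain "is" js where "g = word is" "h = word js" "set is \<subseteq> {..DIM('a)}" "set js \<subseteq> {..DIM('a)}"
    using assms by (auto simp: words_def lists_eq_set)
  then have "g \<circ> h = word (is @ js)" "set (is @ js) \<subseteq> {..DIM('a)}"
    by (auto simp: word_append)
  then show ?thesis unfolding words_def lists_eq_set by blast
qed

lemma word_rev:
  "set is \<subseteq> {..DIM('a)} \<Longrightarrow> word (rev is) (word is x) = x"
proof (induction "is")
  case (Cons i js)
  then show ?case
    by (simp add: word_append affine_reflection_involution[OF affine_simple_root])
qed simp

lemma words_inverse:
  assumes "g \<in> words" obtains h where "h \<in> words" "\<And>x. h (g x) = x" "\<And>x. g (h x) = x"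
proof -
  obtain "is" where "is": "set is \<subseteq> {..DIM('a)}" "g = word is"
    using assms by (auto simp: words_def lists_eq_set)
  then have "word (rev is) \<in> words" unfolding words_def lists_eq_set by auto
  moreover have "word is (word (rev is) x) = x" for x using word_rev[of "rev is" x] "is" by simp
  ultimately show ?thesis using that word_rev "is" by blast
qed

text \<open>The exchange condition. While letters are stripped off from the left, \<open>p\<close>
  is replaced by its image and stays positive unless it is the simple root of the current letter. It
  cannot stay positive to the end, since \<open>x\<close> lies in the alcove; at that letter the
  conjugation rule gives the identity.\<close>

lemma word_exchange:
  assumes "set js \<subseteq> {..DIM('a)}" "positive p" "x \<in> alcove" "affine_value p (word js x) < 0"
  obtains ks j ls where "js = ks @ j # ls"
    "\<And>y. affine_reflection p (word ks y) = word ks (simple_reflection j y)"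
  using assms
proof (induction js arbitrary: p thesis)
  case Nil
  then show ?case by (force simp: positive_def)
next
  case (Cons j js)
  have j: "j \<le> DIM('a)" using Cons.prems by simp
  have p: "p \<in> affine_roots" using Cons.prems by (simp add: positive_def)
  show ?case
  proof (cases "p = affine_simple j")
    case True
    then show ?thesis using Cons.prems(1)[of "[]" j js] by simp
  next
    case False
    let ?r = "act (affine_simple j) p"
    have "positive ?r" by (rule positive_act_simple[OF Cons.prems(3) j False])
    moreover have "affine_value ?r (word js x) < 0"
      using Cons.prems(5) by (simp add: affine_value_reflection[OF affine_simple_root[OF j] p])
    ultimately obtain ks i ls where js: "js = ks @ i # ls"
      "\<And>y. affine_reflection ?r (word ks y) = word ks (simple_reflection i y)"
      using Cons.IH[of ?r] Cons.prems by auto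
    show ?thesis
    proof (rule Cons.prems(1))
      show "j # js = (j # ks) @ i # ls" using js by simp
      show "affine_reflection p (word (j # ks) y) = word (j # ks) (simple_reflection i y)" for y
        by (simp add: affine_reflection_conj[OF affine_simple_root[OF j] p] js(2))
    qed
  qed
qed

text \<open>Freeness of the action on alcoves. If a nonempty word returns to the alcove, its tail
  ends on the far side of the wall of the first letter; exchange then produces a word for the same
  map that is shorter by two letters.\<close>

lemma word_fixes_alcove:
  assumes "set is \<subseteq> {..DIM('a)}" "x \<in> alcove" "word is x \<in> alcove"
  shows "word is = id"
  using assms
proof (induction "length is" arbitrary: "is" rule: less_induct)
  case less
  show ?case
  proof (cases "is")
    case (Cons i js)
    have i: "i \<le> DIM('a)" and js: "set js \<subseteq> {..DIM('a)}" using less.prems Cons by auto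
    have "affine_value (affine_simple i) (word js x)
       = - affine_value (affine_simple i) (word is x)"
      using affine_value_reflection_self[OF affine_simple_root[OF i], of "word js x"] Cons by simp
    also have "\<dots> < 0" using less.prems(3) i by simp
    finally obtain ks j ls where j: "js = ks @ j # ls"
      "\<And>y. simple_reflection i (word ks y) = word ks (simple_reflection j y)"
      using word_exchange[OF js positive_affine_simple[OF i] less.prems(2)] by metis
    \<comment> \<open>Exchange turns \<open>i # ks @ j # ls\<close> into
      \<open>ks @ j # j # ls\<close>, and the doubled letter cancels.\<close>
    have "word is y = word (ks @ ls) y" for y
      using js by (simp add: Cons j word_append affine_reflection_involution[OF affine_simple_root])
    then have eq: "word is = word (ks @ ls)" by blast
    have "word (ks @ ls) = id"
      using less.prems js j(1) by (intro less.hyps) (auto simp: Cons eq[symmetric])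
    then show ?thesis using eq by simp
  qed simp
qed

lemma simple_reflection_words: "i \<le> DIM('a) \<Longrightarrow> simple_reflection i \<in> words"
proof -
  assume "i \<le> DIM('a)"
  moreover have "word [i] = simple_reflection i" by auto
  ultimately show ?thesis unfolding words_def lists_eq_set by (intro image_eqI[of _ _ "[i]"]) auto
qed

text \<open>Descent on the sum of the coefficients of \<open>p\<close>, which is \<open>cox\<close>
  times its value at the centre. From \<open>fst p \<bullet> fst p > 0\<close> some wall has a
  positive inner product with \<open>p\<close>; reflecting in it lowers the sum, and conjugating
  back recovers the reflection of \<open>p\<close>.\<close>

lemma positive_reflection_words:
  assumes "positive p"
  shows "affine_reflection p \<in> words"
  using assms
proof (induction "nat \<lfloor>cox * affine_value p ((1 / cox) *\<^sub>R \<rho>)\<rfloor>" arbitrary: p rule: less_induct)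
  case less
  let ?z = "(1 / cox) *\<^sub>R \<rho>"
  have p: "p \<in> affine_roots" using less.prems by (simp add: positive_def)
  obtain m :: "nat \<Rightarrow> int" where f: "fst p = (\<Sum>i\<le>DIM('a). of_int (m i) *\<^sub>R \<alpha> i)" "m 0 = snd p"
    and nn: "\<forall>i\<le>DIM('a). m i \<ge> 0"
    and m: "\<And>x. affine_value p x = (\<Sum>i\<le>DIM('a). of_int (m i) * affine_value (affine_simple i) x)"
    by (rule positive_coeffs[OF less.prems]) (rule that; assumption)
  have "cox * affine_value p ?z = (\<Sum>i\<le>DIM('a). of_int (m i))"
    unfolding m sum_distrib_left using cox_gt_1 by (intro sum.cong) (auto simp: affine_simple_center)
  then have ht: "cox * affine_value p ?z = of_int (\<Sum>i\<le>DIM('a). m i)" by simp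
  moreover have "affine_value p ?z > 0" using less.prems alcove_nonempty by (auto simp: positive_def)
  ultimately have ht_pos: "(\<Sum>i\<le>DIM('a). m i) > 0" using cox_gt_1
    by (metis less_trans mult_pos_pos of_int_0_less_iff zero_less_one)
  have "\<exists>j\<le>DIM('a). \<alpha> j \<bullet> fst p > 0"
  proof (rule ccontr)
    assume "\<not> ?thesis"
    then have "(\<Sum>i\<le>DIM('a). of_int (m i) * (\<alpha> i \<bullet> fst p)) \<le> 0"
      using nn by (intro sum_nonpos mult_nonneg_nonpos) (auto simp: not_less)
    moreover have "fst p \<bullet> fst p = (\<Sum>i\<le>DIM('a). of_int (m i) * (\<alpha> i \<bullet> fst p))"
      by (subst f(1)) (simp add: inner_sum_left)
    ultimately show False using root_inner_pos[of "fst p"] p by auto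
  qed
  then obtain j where j: "j \<le> DIM('a)" "\<alpha> j \<bullet> fst p > 0" by blast
  show ?case
  proof (cases "p = affine_simple j")
    case True
    then show ?thesis using simple_reflection_words j by simp
  next
    case False
    let ?r = "act (affine_simple j) p"
    note aj = affine_simple_root[OF j(1)]
    have n: "cartan (\<alpha> j) (fst p) > 0"
      using of_int_cartan[of "\<alpha> j" "fst p"] alpha_root[OF j(1)] p j(2) root_inner_pos[of "\<alpha> j"]
      by (metis divide_pos_pos mem_Times_iff mult_pos_pos of_int_0_less_iff zero_less_numeral)
    have "affine_value ?r ?z = affine_value p ?z - of_int (cartan (\<alpha> j) (fst p)) * (1 / cox)"
      unfolding affine_value_act[OF aj p] affine_simple_center[OF j(1)] by (simp add: affine_simple_def)
    then have ht': "cox * affine_value ?r ?z = of_int ((\<Sum>i\<le>DIM('a). m i) - cartan (\<alpha> j) (fst p))"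
      using ht cox_gt_1 by (simp add: right_diff_distrib)
    have "nat \<lfloor>cox * affine_value ?r ?z\<rfloor> < nat \<lfloor>cox * affine_value p ?z\<rfloor>"
      unfolding ht ht' floor_of_int using n ht_pos by linarith
    then have r: "affine_reflection ?r \<in> words"
      by (rule less.hyps[OF _ positive_act_simple[OF less.prems j(1) False]])
    have "affine_reflection p x = simple_reflection j (affine_reflection ?r (simple_reflection j x))" for x
      using affine_reflection_conj[OF aj p, of "simple_reflection j x"] affine_reflection_involution[OF aj]
      by simp
    then have "affine_reflection p = simple_reflection j \<circ> (affine_reflection ?r \<circ> simple_reflection j)"
      by (auto simp: fun_eq_iff)
    then show ?thesis using simple_reflection_words[OF j(1)] words_comp r by metis
  qed
qed

lemma affine_reflection_words: "p \<in> affine_roots \<Longrightarrow> affine_reflection p \<in> words"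
proof -
  have "affine_reflection (- p) = affine_reflection p"
    by (simp add: fun_eq_iff affine_reflection_def affine_value_uminus)
  moreover assume "p \<in> affine_roots"
  ultimately show ?thesis using positive_cases positive_reflection_words by metis
qed

section \<open>The coroot lattice and the Weyl group\<close>

abbreviation coroot :: "'a \<Rightarrow> 'a" where
  "coroot \<beta> \<equiv> (2 / (\<beta> \<bullet> \<beta>)) *\<^sub>R \<beta>"

lemma coroot_lattice_0: "0 \<in> coroots"
  unfolding coroot_lattice_def mem_Collect_eq by (rule exI[of _ "\<lambda>_. 0"]) simp

lemma coroot_lattice_add: "x \<in> coroots \<Longrightarrow> y \<in> coroots \<Longrightarrow> x + y \<in> coroots"
proof -
  assume "x \<in> coroots" "y \<in> coroots"
  then obtain m m' :: "'a \<Rightarrow> int" where "x = (\<Sum>\<beta>\<in>\<Phi>. of_int (m \<beta>) *\<^sub>R coroot \<beta>)" "y = (\<Sum>\<beta>\<in>\<Phi>. of_int (m' \<beta>) *\<^sub>R coroot \<beta>)"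
    unfolding coroot_lattice_def by blast
  then have "x + y = (\<Sum>\<beta>\<in>\<Phi>. of_int (m \<beta> + m' \<beta>) *\<^sub>R coroot \<beta>)"
    by (simp only: sum.distrib[symmetric] scaleR_add_left[symmetric] of_int_add)
  then show ?thesis unfolding coroot_lattice_def mem_Collect_eq
    by (intro exI[of _ "\<lambda>\<beta>. m \<beta> + m' \<beta>"] conjI TrueI)
qed

lemma coroot_lattice_uminus: "x \<in> coroots \<Longrightarrow> - x \<in> coroots"
proof -
  assume "x \<in> coroots"
  then obtain m :: "'a \<Rightarrow> int" where "x = (\<Sum>\<beta>\<in>\<Phi>. of_int (m \<beta>) *\<^sub>R coroot \<beta>)"
    unfolding coroot_lattice_def by blast
  then have "- x = (\<Sum>\<beta>\<in>\<Phi>. of_int (- m \<beta>) *\<^sub>R coroot \<beta>)"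
    by (simp only: sum_negf[symmetric] scaleR_minus_left[symmetric] of_int_minus)
  then show ?thesis unfolding coroot_lattice_def mem_Collect_eq
    by (intro exI[of _ "\<lambda>\<beta>. - m \<beta>"] conjI TrueI)
qed

lemma coroot_lattice_diff: "x \<in> coroots \<Longrightarrow> y \<in> coroots \<Longrightarrow> x - y \<in> coroots"
  using coroot_lattice_add[of x "- y"] coroot_lattice_uminus[of y] by simp

lemma coroot_in_lattice: "\<beta> \<in> \<Phi> \<Longrightarrow> of_int k *\<^sub>R coroot \<beta> \<in> coroots"
proof -
  assume \<beta>: "\<beta> \<in> \<Phi>"
  have "(\<Sum>\<gamma>\<in>\<Phi>. of_int (if \<gamma> = \<beta> then k else 0) *\<^sub>R coroot \<gamma>) = (\<Sum>\<gamma>\<in>\<Phi>. if \<gamma> = \<beta> then of_int k *\<^sub>R coroot \<beta> else 0)"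
    by (intro sum.cong) auto
  also have "\<dots> = of_int k *\<^sub>R coroot \<beta>" using \<beta> finite_roots by (simp only: sum.delta if_True)
  finally show ?thesis
    unfolding coroot_lattice_def mem_Collect_eq by (intro exI[of _ "\<lambda>\<gamma>. if \<gamma> = \<beta> then k else 0"]) simp
qed

lemma root_coroot_Ints: "\<gamma> \<in> \<Phi> \<Longrightarrow> v \<in> coroots \<Longrightarrow> \<gamma> \<bullet> v \<in> \<int>"
proof -
  assume \<gamma>: "\<gamma> \<in> \<Phi>" and "v \<in> coroots"
  then obtain m :: "'a \<Rightarrow> int" where v: "v = (\<Sum>\<beta>\<in>\<Phi>. of_int (m \<beta>) *\<^sub>R coroot \<beta>)"
    unfolding coroot_lattice_def by blast
  have "\<gamma> \<bullet> v = (\<Sum>\<beta>\<in>\<Phi>. of_int (m \<beta>) * (2 * (\<beta> \<bullet> \<gamma>) / (\<beta> \<bullet> \<beta>)))"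
    unfolding v inner_sum_right by (intro sum.cong) (auto simp: inner_commute)
  also have "\<dots> \<in> \<int>" using cartan_Ints \<gamma> by (intro Ints_sum Ints_mult) auto
  finally show ?thesis .
qed

lemma reflection_coroot_lattice:
  assumes "\<gamma> \<in> \<Phi>" "v \<in> coroots" shows "reflection \<gamma> v \<in> coroots"
proof -
  obtain k where "\<gamma> \<bullet> v = of_int k" using root_coroot_Ints[OF assms] by (auto elim: Ints_cases)
  then have "reflection \<gamma> v = v - of_int k *\<^sub>R coroot \<gamma>" by (simp add: reflection_def mult.commute)
  then show ?thesis using coroot_lattice_diff assms coroot_in_lattice by metis
qed

lemma weyl_comp: "w \<in> weyl_group \<Phi> \<Longrightarrow> u \<in> weyl_group \<Phi> \<Longrightarrow> w \<circ> u \<in> weyl_group \<Phi>"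
  by (induction rule: weyl_group.induct) (auto simp: comp_assoc intro: weyl_group.intros)

lemma reflection_weyl: "\<beta> \<in> \<Phi> \<Longrightarrow> reflection \<beta> \<in> weyl_group \<Phi>"
  using weyl_reflection[OF weyl_id, of \<beta> \<Phi>] by simp

lemma weyl_inverse:
  assumes "w \<in> weyl_group \<Phi>"
  obtains u where "u \<in> weyl_group \<Phi>" "\<And>x. u (w x) = x" "\<And>x. w (u x) = x"
proof -
  have "\<exists>u\<in>weyl_group \<Phi>. (\<forall>x. u (w x) = x) \<and> (\<forall>x. w (u x) = x)"
    using assms
  proof induction
    case weyl_id
    then show ?case using weyl_group.weyl_id by (intro bexI[of _ id]) auto
  next
    case (weyl_reflection w \<beta>)
    then obtain u where "u \<in> weyl_group \<Phi>" "\<forall>x. u (w x) = x" "\<forall>x. w (u x) = x" by blast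
    then show ?case using reflection_weyl[OF weyl_reflection.hyps(2)] weyl_comp
      by (intro bexI[of _ "u \<circ> reflection \<beta>"]) auto
  qed
  then show ?thesis using that by blast
qed

lemma linear_weyl: "w \<in> weyl_group \<Phi> \<Longrightarrow> linear w"
proof (induction rule: weyl_group.induct)
  case weyl_id
  then show ?case by (simp add: id_def linear_ident)
next
  case (weyl_reflection w \<beta>)
  show ?case by (rule linear_compose[OF weyl_reflection.IH linear_reflection])
qed

lemma inner_weyl: "w \<in> weyl_group \<Phi> \<Longrightarrow> w x \<bullet> w y = x \<bullet> y"
  by (induction rule: weyl_group.induct) (simp_all add: inner_reflection)

lemma weyl_root: "w \<in> weyl_group \<Phi> \<Longrightarrow> \<beta> \<in> \<Phi> \<Longrightarrow> w \<beta> \<in> \<Phi>"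
  by (induction rule: weyl_group.induct) (simp_all add: reflection_root)

text \<open>An element is linear, hence determined by its restriction to the spanning finite set of
  roots, which it maps into itself.\<close>

lemma finite_weyl: "finite (weyl_group \<Phi>)"
proof -
  have "inj_on (\<lambda>w. restrict w \<Phi>) (weyl_group \<Phi>)"
  proof (rule inj_onI)
    fix w u assume w: "w \<in> weyl_group \<Phi>" and u: "u \<in> weyl_group \<Phi>"
      and eq: "restrict w \<Phi> = restrict u \<Phi>"
    have "w \<beta> = u \<beta>" if "\<beta> \<in> \<Phi>" for \<beta> using fun_cong[OF eq, of \<beta>] that by simp
    then show "w = u"
      using linear_eq_on_span[OF linear_weyl[OF w] linear_weyl[OF u], of \<Phi>] span_roots by auto
  qed
  moreover have "(\<lambda>w. restrict w \<Phi>) ` weyl_group \<Phi> \<subseteq> \<Phi> \<rightarrow>\<^sub>E \<Phi>"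
    using weyl_root by auto
  ultimately show ?thesis using finite_roots by (meson finite_PiE finite_imageD finite_subset)
qed

lemma weyl_words: "w \<in> weyl_group \<Phi> \<Longrightarrow> w \<in> words"
proof (induction rule: weyl_group.induct)
  case weyl_id
  then show ?case unfolding words_def lists_eq_set by (intro image_eqI[of _ _ "[]"]) auto
next
  case (weyl_reflection w \<beta>)
  have "affine_reflection (\<beta>, 0) \<in> words" using weyl_reflection.hyps by (intro affine_reflection_words) simp
  moreover have "affine_reflection (\<beta>, 0) = reflection \<beta>" by (simp add: fun_eq_iff affine_reflection_eq)
  ultimately show ?case using words_comp weyl_reflection.IH by metis
qed

text \<open>The product of the reflections in two neighbouring parallel hyperplanes is the
  translation by a coroot; multiples and sums are compositions.\<close>

lemma translation_words: "v \<in> coroots \<Longrightarrow> (\<lambda>x. v + x) \<in> words"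
proof -
  have root: "(\<lambda>x. coroot \<beta> + x) \<in> words" if "\<beta> \<in> \<Phi>" for \<beta>
  proof -
    have eq: "(\<lambda>x. coroot \<beta> + x) = affine_reflection (\<beta>, -1) \<circ> affine_reflection (\<beta>, 0)"
      by (simp add: fun_eq_iff affine_reflection_eq)
    show ?thesis unfolding eq using that by (intro words_comp affine_reflection_words) auto
  qed
  have "(\<lambda>x. 0 + x) \<in> words" using weyl_words[OF weyl_id] by (simp add: id_def)
  then have nat_mult: "(\<lambda>x. real k *\<^sub>R coroot \<beta> + x) \<in> words" if "\<beta> \<in> \<Phi>" for \<beta> k
  proof (induction k)
    case (Suc k)
    have eq: "(\<lambda>x. real (Suc k) *\<^sub>R coroot \<beta> + x) = (\<lambda>x. coroot \<beta> + x) \<circ> (\<lambda>x. real k *\<^sub>R coroot \<beta> + x)"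
      by (simp add: fun_eq_iff scaleR_add_left del: scaleR_scaleR)
    show ?case unfolding eq using Suc by (intro words_comp root that)
  qed simp
  have int_mult: "(\<lambda>x. of_int k *\<^sub>R coroot \<beta> + x) \<in> words" if "\<beta> \<in> \<Phi>" for \<beta> k
  proof (cases "k \<ge> 0")
    case True
    then have eq: "of_int k = real (nat k)" by simp
    show ?thesis unfolding eq by (rule nat_mult[OF that])
  next
    case False
    then have eq: "of_int k *\<^sub>R coroot \<beta> = real (nat (- k)) *\<^sub>R coroot (- \<beta>)" by simp
    show ?thesis unfolding eq by (rule nat_mult[OF uminus_root[OF that]])
  qed
  have "(\<lambda>x. (\<Sum>\<beta>\<in>A. of_int (m \<beta>) *\<^sub>R coroot \<beta>) + x) \<in> words" if "A \<subseteq> \<Phi>" for A and m :: "'a \<Rightarrow> int"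
    using finite_subset[OF that finite_roots] that
  proof (induction A)
    case empty
    then show ?case using \<open>(\<lambda>x. 0 + x) \<in> words\<close> by simp
  next
    case (insert \<beta> A)
    have eq: "(\<lambda>x. (\<Sum>\<beta>\<in>insert \<beta> A. of_int (m \<beta>) *\<^sub>R coroot \<beta>) + x)
      = (\<lambda>x. of_int (m \<beta>) *\<^sub>R coroot \<beta> + x) \<circ> (\<lambda>x. (\<Sum>\<beta>\<in>A. of_int (m \<beta>) *\<^sub>R coroot \<beta>) + x)"
      using insert.hyps by (simp add: fun_eq_iff add.assoc)
    show ?case unfolding eq using insert.IH insert.prems by (intro words_comp int_mult) auto
  qed
  moreover assume "v \<in> coroots"
  ultimately show ?thesis unfolding coroot_lattice_def by blast
qed

text \<open>Each letter is a linear reflection followed by a translation by 0 or by a negative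
  coroot, and reflections preserve the coroot lattice.\<close>

lemma word_decomposition:
  assumes "set is \<subseteq> {..DIM('a)}"
  shows "\<exists>v\<in>coroots. \<exists>w\<in>weyl_group \<Phi>. \<forall>x. word is x = v + w x"
  using assms
proof (induction "is")
  case Nil
  then show ?case using coroot_lattice_0 weyl_id by (intro bexI[of _ 0] bexI[of _ id]) auto
next
  case (Cons i js)
  then obtain v w where v: "v \<in> coroots" and w: "w \<in> weyl_group \<Phi>" and x: "\<And>x. word js x = v + w x"
    by auto
  have i: "\<alpha> i \<in> \<Phi>" using alpha_root Cons.prems by simp
  let ?k = "snd (affine_simple i)"
  have "word (i # js) x = (reflection (\<alpha> i) v - of_int ?k *\<^sub>R coroot (\<alpha> i)) + (reflection (\<alpha> i) \<circ> w) x" for x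
    by (simp add: x affine_reflection_eq reflection_add affine_simple_def mult.commute)
  moreover have "reflection (\<alpha> i) v - of_int ?k *\<^sub>R coroot (\<alpha> i) \<in> coroots"
    using v i coroot_lattice_diff reflection_coroot_lattice coroot_in_lattice by metis
  moreover have "reflection (\<alpha> i) \<circ> w \<in> weyl_group \<Phi>" using w i by (rule weyl_reflection)
  ultimately show ?case by blast
qed

lemma cartan_self: "\<beta> \<in> \<Phi> \<Longrightarrow> cartan \<beta> \<beta> = 2"
  using root_inner_pos[of \<beta>] by (simp add: cartan_def)

lemma act_self:
  assumes "p \<in> affine_roots" shows "act p p = - p"
proof -
  have "fst p \<in> \<Phi>" using assms by auto
  then have "reflection (fst p) (fst p) = - fst p"
    using root_inner_pos[of "fst p"] by (simp add: reflection_def scaleR_2)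
  then show ?thesis using \<open>fst p \<in> \<Phi>\<close> by (simp add: act_def cartan_self prod_eq_iff)
qed

lemma act_act:
  assumes "p \<in> affine_roots" "r \<in> affine_roots"
  shows "act p (act p r) = r"
proof -
  have "real_of_int (cartan (fst p) (reflection (fst p) (fst r))) = - of_int (cartan (fst p) (fst r))"
    using assms root_inner_pos[of "fst p"] reflection_root
    by (auto simp: of_int_cartan) (auto simp: reflection_def inner_diff_right field_simps)
  then have "cartan (fst p) (reflection (fst p) (fst r)) = - cartan (fst p) (fst r)"
    by (metis of_int_eq_iff of_int_minus)
  then show ?thesis by (simp add: act_def prod_eq_iff)
qed

section \<open>Simple transitivity on alcoves\<close>

definition separating :: "'a \<Rightarrow> ('a \<times> int) set" where
  "separating x = {p. positive p \<and> affine_value p x < 0}"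

lemma finite_separating: "finite (separating x)"
proof (rule finite_subset)
  let ?z = "(1 / cox) *\<^sub>R \<rho>"
  \<comment> \<open>For a fixed root, the constant term is confined between those of the parallel
    hyperplanes through the centre of the alcove and through \<open>x\<close>.\<close>
  show "separating x \<subseteq> (SIGMA \<beta>:\<Phi>. {\<lfloor>- (\<beta> \<bullet> ?z)\<rfloor>..\<lceil>- (\<beta> \<bullet> x)\<rceil>})"
  proof
    fix p assume "p \<in> separating x"
    then have p: "fst p \<in> \<Phi>" "affine_value p ?z > 0" "affine_value p x < 0"
      using alcove_nonempty unfolding separating_def positive_def by auto
    then have "- (fst p \<bullet> ?z) < of_int (snd p)" "of_int (snd p) < - (fst p \<bullet> x)"
      by (simp_all add: affine_value_def)
    then have "\<lfloor>- (fst p \<bullet> ?z)\<rfloor> \<le> snd p" "snd p \<le> \<lceil>- (fst p \<bullet> x)\<rceil>"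
      by (simp_all add: floor_le_iff le_ceiling_iff)
    with p(1) show "p \<in> (SIGMA \<beta>:\<Phi>. {\<lfloor>- (\<beta> \<bullet> ?z)\<rfloor>..\<lceil>- (\<beta> \<bullet> x)\<rceil>})" by (cases p) auto
  qed
qed (simp add: finite_roots)

text \<open>Reflecting in a wall that separates \<open>x\<close> from the alcove removes this
  hyperplane from the separating ones and maps the remaining ones injectively, so their number
  drops.\<close>

lemma ex_word_into_alcove:
  assumes "\<And>p. p \<in> affine_roots \<Longrightarrow> affine_value p x \<noteq> 0"
  shows "\<exists>g\<in>words. g x \<in> alcove"
  using assms
proof (induction "card (separating x)" arbitrary: x rule: less_induct)
  case less
  show ?case
  proof (cases "x \<in> alcove")
    case True
    then show ?thesis using weyl_words[OF weyl_id] by (intro bexI[of _ id]) auto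
  next
    case False
    then obtain i where i: "i \<le> DIM('a)" "\<not> affine_value (affine_simple i) x > 0" by blast
    note ai = affine_simple_root[OF i(1)]
    have neg: "affine_value (affine_simple i) x < 0" using i(2) less.prems[OF ai] by simp
    let ?y = "simple_reflection i x"
    have "act (affine_simple i) ` separating ?y \<subseteq> separating x - {affine_simple i}"
    proof (intro subsetI, elim imageE, hypsubst)
      fix p assume p: "p \<in> separating ?y"
      then have p': "p \<in> affine_roots" "positive p" by (auto simp: separating_def positive_def)
      have "p \<noteq> affine_simple i"
        using p neg affine_value_reflection_self[OF ai, of x] by (auto simp: separating_def)
      then have "act (affine_simple i) p \<in> separating x"
        using p positive_act_simple[OF p'(2) i(1)] affine_value_reflection[OF ai p'(1), of x]
        by (simp add: separating_def)
      moreover have "act (affine_simple i) p \<noteq> affine_simple i"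
      proof
        assume "act (affine_simple i) p = affine_simple i"
        then have "p = - affine_simple i" using act_act[OF ai p'(1)] act_self[OF ai] by simp
        then have "positive (- affine_simple i)" using p'(2) by simp
        moreover have "positive (affine_simple i)" using positive_affine_simple[OF i(1)] .
        ultimately show False
          using alcove_nonempty unfolding positive_def affine_value_uminus by force
      qed
      ultimately show "act (affine_simple i) p \<in> separating x - {affine_simple i}" by blast
    qed
    moreover have "inj_on (act (affine_simple i)) (separating ?y)"
      using act_act[OF ai] unfolding separating_def positive_def
      by (intro inj_on_inverseI[of _ "act (affine_simple i)"]) auto
    ultimately have "card (separating ?y) \<le> card (separating x - {affine_simple i})"
      using finite_separating by (meson card_inj_on_le finite_Diff)
    also have "\<dots> < card (separating x)"
      using neg positive_affine_simple[OF i(1)] finite_separating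
      by (intro card_Diff1_less) (auto simp: separating_def)
    finally have "\<exists>g\<in>words. g ?y \<in> alcove"
      using less.prems affine_value_reflection[OF ai] act_root[OF ai]
      by (intro less.hyps) auto
    then obtain g where "g \<in> words" "g ?y \<in> alcove" by blast
    then show ?thesis
      by (intro bexI[of _ "g \<circ> simple_reflection i"] words_comp simple_reflection_words i(1)) auto
  qed
qed

lemma alcove_exists:
  assumes "\<And>p. p \<in> affine_roots \<Longrightarrow> affine_value p x \<noteq> 0"
  obtains v w y where "v \<in> coroots" "w \<in> weyl_group \<Phi>" "y \<in> alcove" "x = v + w y"
proof -
  have "\<exists>g\<in>words. g x \<in> alcove" using assms by (rule ex_word_into_alcove)
  then obtain g where g: "g \<in> words" "g x \<in> alcove" ..
  obtain h where h: "h \<in> words" "h (g x) = x" by (rule words_inverse[OF g(1)]) blast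
  then obtain "is" where "set is \<subseteq> {..DIM('a)}" "h = word is"
    unfolding words_def lists_eq_set by blast
  then obtain v w where "v \<in> coroots" "w \<in> weyl_group \<Phi>" "\<And>x. h x = v + w x"
    using word_decomposition by blast
  then show ?thesis using that[of v w "g x"] g h by simp
qed

text \<open>The inverse of one affine map followed by the other takes a point of the alcove into the
  alcove and is the identity by freeness. The equal affine maps are compared at 0, which isolates
  the translations.\<close>

lemma alcove_unique:
  assumes "v \<in> coroots" "w \<in> weyl_group \<Phi>" "y \<in> alcove"
    and "v' \<in> coroots" "w' \<in> weyl_group \<Phi>" "y' \<in> alcove"
    and eq: "v + w y = v' + w' y'"
  shows "v = v'" "w = w'"
proof -
  have g: "(\<lambda>x. v + x) \<circ> w \<in> words" and g': "(\<lambda>x. v' + x) \<circ> w' \<in> words"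
    using assms(1,2,4,5) by (auto intro!: words_comp intro: translation_words weyl_words)
  obtain h where h: "h \<in> words" "\<And>x. h (((\<lambda>x. v' + x) \<circ> w') x) = x" "\<And>x. ((\<lambda>x. v' + x) \<circ> w') (h x) = x"
    by (rule words_inverse[OF g']) (rule that; assumption)
  have "h \<circ> ((\<lambda>x. v + x) \<circ> w) \<in> words" using words_comp[OF h(1) g] .
  then obtain ks where ks: "set ks \<subseteq> {..DIM('a)}" "h \<circ> ((\<lambda>x. v + x) \<circ> w) = word ks"
    unfolding words_def lists_eq_set by blast
  have "word ks y = y'" unfolding ks(2)[symmetric] using h(2)[of y'] by (simp add: eq)
  then have "word ks = id" using word_fixes_alcove[OF ks(1) assms(3)] assms(6) by simp
  then have "h (v + w x) = x" for x using fun_cong[OF ks(2), of x] by simp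
  then have *: "v + w x = v' + w' x" for x using h(3)[of "v + w x"] by simp
  from *[of 0] show "v = v'"
    by (simp add: linear_0[OF linear_weyl[OF assms(2)]] linear_0[OF linear_weyl[OF assms(5)]])
  with * show "w = w'" by auto
qed

section \<open>Counting coweights\<close>

lemma simple_coweight_Ints: "x \<in> coweights \<Longrightarrow> i \<le> DIM('a) \<Longrightarrow> \<alpha> i \<bullet> x \<in> \<int>"
proof (cases "i = 0")
  case True
  assume "x \<in> coweights"
  then show ?thesis unfolding True alpha_0 inner_minus_left theta_inner
    by (intro Ints_minus Ints_sum Ints_mult) (auto simp: coweight_lattice_def)
qed (auto simp: coweight_lattice_def)

lemma root_coweight_Ints:
  assumes "x \<in> coweights" "\<beta> \<in> \<Phi>" shows "\<beta> \<bullet> x \<in> \<int>"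
proof -
  obtain m :: "nat \<Rightarrow> int" where "\<beta> = (\<Sum>i\<le>DIM('a). of_int (m i) *\<^sub>R \<alpha> i)"
    using affine_root_coeffs[OF assms(2)] by blast
  then have "\<beta> \<bullet> x = (\<Sum>i\<le>DIM('a). of_int (m i) * (\<alpha> i \<bullet> x))" by (simp add: inner_sum_left)
  then show ?thesis using simple_coweight_Ints[OF assms(1)] by (auto intro!: Ints_sum Ints_mult)
qed

lemma coweight_0: "0 \<in> coweights"
  by (simp add: coweight_lattice_def)

lemma coweight_add: "x \<in> coweights \<Longrightarrow> y \<in> coweights \<Longrightarrow> x + y \<in> coweights"
  by (simp add: coweight_lattice_def inner_add_right)

lemma coweight_diff: "x \<in> coweights \<Longrightarrow> y \<in> coweights \<Longrightarrow> x - y \<in> coweights"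
  by (simp add: coweight_lattice_def inner_diff_right)

lemma coweight_uminus: "x \<in> coweights \<Longrightarrow> - x \<in> coweights"
  by (simp add: coweight_lattice_def)

lemma coweight_mult: "x \<in> coweights \<Longrightarrow> of_int k *\<^sub>R x \<in> coweights"
  by (simp add: coweight_lattice_def)

lemma coroot_coweight: "v \<in> coroots \<Longrightarrow> v \<in> coweights"
  unfolding coweight_lattice_def by (auto intro!: root_coroot_Ints alpha_root)

lemma weyl_coweight:
  assumes "w \<in> weyl_group \<Phi>" "x \<in> coweights" shows "w x \<in> coweights"
proof -
  obtain u where u: "u \<in> weyl_group \<Phi>" "\<And>x. w (u x) = x"
    by (rule weyl_inverse[OF assms(1)]) blast
  have "\<alpha> i \<bullet> w x \<in> \<int>" if "i \<in> {1..DIM('a)}" for i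
  proof -
    have "\<alpha> i \<bullet> w x = w (u (\<alpha> i)) \<bullet> w x" by (simp add: u)
    also have "\<dots> = u (\<alpha> i) \<bullet> x" by (rule inner_weyl[OF assms(1)])
    also have "\<dots> \<in> \<int>"
      using that by (intro root_coweight_Ints[OF assms(2)] weyl_root[OF u(1)] alpha_root) auto
    finally show ?thesis .
  qed
  then show ?thesis by (simp add: coweight_lattice_def)
qed

section \<open>Cells and their cardinalities\<close>

definition wall :: "int \<Rightarrow> ('a \<Rightarrow> 'a) \<Rightarrow> nat \<Rightarrow> 'a \<Rightarrow> real" where
  "wall q w i x = w (\<alpha> i) \<bullet> x + (if i = 0 then of_int q else 0)"

text \<open>The functions \<open>wall q w i\<close> are the distances of the overview: pulled back
  along \<open>w\<close>, they are the wall functions of the alcove dilated by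
  \<open>q\<close>.\<close>

lemma wall_weyl: "w \<in> weyl_group \<Phi> \<Longrightarrow> wall q w i (w x) = \<alpha> i \<bullet> x + (if i = 0 then of_int q else 0)"
  by (simp add: wall_def inner_weyl)

lemma wall_Ints: "w \<in> weyl_group \<Phi> \<Longrightarrow> x \<in> coweights \<Longrightarrow> i \<le> DIM('a) \<Longrightarrow> wall q w i x \<in> \<int>"
  using root_coweight_Ints[OF _ weyl_root[OF _ alpha_root], of x w i] by (simp add: wall_def)

lemma sum_wall:
  assumes "w \<in> weyl_group \<Phi>"
  shows "(\<Sum>i\<le>DIM('a). real (c i) * wall q w i x) = of_int q"
proof -
  obtain u where u: "\<And>x. w (u x) = x" by (rule weyl_inverse[OF assms]) blast
  show ?thesis using sum_affine_simple[of "u x" "of_int q"] wall_weyl[OF assms, of q _ "u x"] by (simp add: u)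
qed

text \<open>On coweights the wall functions are integral coordinates bound only by
  \<open>\<Sum> c\<^sub>i y\<^sub>i = q\<close>. Subtracting the lower bounds \<open>b i\<close>
  makes them natural numbers and lowers the right-hand side by the weighted sum of the
  bounds.\<close>

lemma card_simplex:
  fixes b :: "nat \<Rightarrow> nat" and q :: int
  assumes w: "w \<in> weyl_group \<Phi>"
  defines "S \<equiv> {x \<in> coweights. \<forall>i\<le>DIM('a). real (b i) \<le> wall q w i x}"
  shows "finite S" "card S = card (solutions c DIM('a) (q - int (\<Sum>i\<le>DIM('a). c i * b i)))"
proof -
  let ?T = "solutions c DIM('a) (q - int (\<Sum>i\<le>DIM('a). c i * b i))"
  define f where "f = (\<lambda>x i. if i \<le> DIM('a) then nat (\<lfloor>wall q w i x\<rfloor> - int (b i)) else 0)"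
  have f: "real (f x i) = wall q w i x - real (b i)" if x: "x \<in> S" and i: "i \<le> DIM('a)" for x i
  proof -
    obtain k where "wall q w i x = of_int k"
      using wall_Ints[OF w, of x i q] x i by (auto simp: S_def elim: Ints_cases)
    moreover have "real (b i) \<le> wall q w i x" using x i by (simp add: S_def)
    ultimately show ?thesis using i by (simp add: f_def)
  qed
  have bij: "bij_betw f S ?T"
    unfolding bij_betw_def
  proof (intro conjI inj_onI equalityI subsetI)
    fix x x' assume x: "x \<in> S" "x' \<in> S" and eq: "f x = f x'"
    obtain u where u: "\<And>x. w (u x) = x" by (rule weyl_inverse[OF w]) blast
    have "wall q w i x = wall q w i x'" if "i \<le> DIM('a)" for i
      using f[OF x(1) that] f[OF x(2) that] eq by simp
    then have "\<alpha> i \<bullet> u x = \<alpha> i \<bullet> u x'" if "i \<in> {1..DIM('a)}" for i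
      using wall_weyl[OF w, of q i "u x"] wall_weyl[OF w, of q i "u x'"] that by (simp add: u)
    then have "u x = u x'" by (rule simple_roots_ext)
    then have "w (u x) = w (u x')" by simp
    then show "x = x'" by (simp only: u)
  next
    fix y assume "y \<in> f ` S"
    then obtain x where x: "x \<in> S" "y = f x" by blast
    have "real (\<Sum>i\<le>DIM('a). c i * y i) = (\<Sum>i\<le>DIM('a). real (c i) * (wall q w i x - real (b i)))"
      using f[OF x(1)] x(2) by simp
    also have "\<dots> = of_int q - real (\<Sum>i\<le>DIM('a). c i * b i)"
      by (simp add: right_diff_distrib sum_subtractf sum_wall[OF w])
    finally have "real_of_int (int (\<Sum>i\<le>DIM('a). c i * y i)) = of_int (q - int (\<Sum>i\<le>DIM('a). c i * b i))"
      by simp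
    then have "int (\<Sum>i\<le>DIM('a). c i * y i) = q - int (\<Sum>i\<le>DIM('a). c i * b i)"
      by (simp only: of_int_eq_iff)
    then show "y \<in> ?T" using x(2) by (simp add: solutions_def f_def)
  next
    fix y assume y: "y \<in> ?T"
    then have "int (\<Sum>i\<le>DIM('a). c i * y i) + int (\<Sum>i\<le>DIM('a). c i * b i) = q"
      by (simp add: solutions_def)
    then have "real_of_int (int (\<Sum>i\<le>DIM('a). c i * y i) + int (\<Sum>i\<le>DIM('a). c i * b i)) = of_int q"
      by (simp only: )
    then have "(\<Sum>i\<le>DIM('a). real (c i) * real (y i + b i)) = of_int q"
      by (simp add: distrib_left sum.distrib)
    then obtain x where x: "\<And>i. i \<le> DIM('a) \<Longrightarrow> \<alpha> i \<bullet> x + (if i = 0 then of_int q else 0) = real (y i + b i)"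
      using ex_simple_values[of "\<lambda>i. real (y i + b i)" "of_int q"] by blast
    have "\<alpha> i \<bullet> x \<in> \<int>" if "i \<in> {1..DIM('a)}" for i using x[of i] that by simp
    then have "w x \<in> coweights" by (intro weyl_coweight[OF w]) (simp add: coweight_lattice_def)
    moreover have wx: "wall q w i (w x) = real (y i + b i)" if "i \<le> DIM('a)" for i
      using x[OF that] by (simp add: wall_weyl[OF w])
    ultimately have S: "w x \<in> S" by (simp add: S_def)
    have "y i = f (w x) i" for i
    proof (cases "i \<le> DIM('a)")
      case True
      then have "real (f (w x) i) = real (y i)" using f[OF S True] wx[OF True] by simp
      then show ?thesis by simp
    next
      case False
      then show ?thesis using y by (simp add: solutions_def f_def)
    qed
    then have "y = f (w x)" by (rule ext)
    then show "y \<in> f ` S" using S by (rule image_eqI)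
  qed
  show "card S = card ?T" using bij by (rule bij_betw_same_card)
  have "finite ?T" by (rule finite_solutions) (rule c_pos)
  then show "finite S" using bij_betw_finite[OF bij] by blast
qed

text \<open>
  The points of the partially closed alcoves of Worpitzky's partition, dilated by \<open>q\<close> (for
  \<open>n = 0\<close>), and those among them that the arrangement modulo \<open>q\<close> leaves uncovered.
\<close>

definition cell :: "int \<Rightarrow> nat \<Rightarrow> ('a \<Rightarrow> 'a) \<Rightarrow> 'a set" where
  "cell q n w = {x \<in> coweights. \<forall>i\<le>DIM('a).
     real (if w (\<alpha> i) \<in> pos_roots then Suc n else 0) \<le> wall q w i x}"

text \<open>Each ascent \<open>i\<close> carries the bound \<open>Suc n\<close> with weight
  \<open>c i\<close>; the total of these is how \<open>asc\<close> enters the count.\<close>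

lemma card_cell:
  assumes "w \<in> weyl_group \<Phi>"
  shows "finite (cell q n w)"
    "card (cell q n w) = card (solutions c DIM('a) (q - int (Suc n * asc \<Phi> \<alpha> c w)))"
proof -
  have "(\<Sum>i\<le>DIM('a). c i * (if w (\<alpha> i) \<in> pos_roots then Suc n else 0))
      = (\<Sum>i \<in> {i \<in> {0..DIM('a)}. w (\<alpha> i) \<in> pos_roots}. c i * Suc n)"
    by (rule sum.mono_neutral_cong_right) auto
  also have "\<dots> = Suc n * asc \<Phi> \<alpha> c w" by (simp only: asc_def sum_distrib_left mult.commute[of _ "Suc n"])
  finally have *: "(\<Sum>i\<le>DIM('a). c i * (if w (\<alpha> i) \<in> pos_roots then Suc n else 0)) = Suc n * asc \<Phi> \<alpha> c w" .
  show "finite (cell q n w)"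
    unfolding cell_def by (rule card_simplex(1)[OF assms])
  show "card (cell q n w) = card (solutions c DIM('a) (q - int (Suc n * asc \<Phi> \<alpha> c w)))"
    unfolding cell_def card_simplex(2)[OF assms] * ..
qed

lemma cell_mono: "cell q n w \<subseteq> cell q 0 w"
proof
  fix x assume "x \<in> cell q n w"
  moreover have "real (if w (\<alpha> i) \<in> pos_roots then Suc 0 else 0) \<le> real (if w (\<alpha> i) \<in> pos_roots then Suc n else 0)" for i
    by simp
  ultimately show "x \<in> cell q 0 w"
    unfolding cell_def mem_Collect_eq by (meson order_trans)
qed

text \<open>Undoing \<open>w\<close> reduces the claim to the signs of the wall functions at the
  displaced point. As \<open>wall q w i x\<close> is an integer, \<open>height_less_iff\<close>
  rewrites each of them as the bound of the cell.\<close>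

lemma cell_0_iff:
  assumes q: "q > 0" and w: "w \<in> weyl_group \<Phi>" and x: "x \<in> coweights"
  shows "x \<in> cell q 0 w \<longleftrightarrow> (\<exists>y\<in>alcove. (1 / of_int q) *\<^sub>R (x - (1 / cox) *\<^sub>R \<rho>) = w y)"
proof -
  obtain u where u: "u \<in> weyl_group \<Phi>" "\<And>x. u (w x) = x" "\<And>x. w (u x) = x"
    by (rule weyl_inverse[OF w]) (rule that; assumption)
  define z where "z = (1 / real_of_int q) *\<^sub>R (x - (1 / cox) *\<^sub>R \<rho>)"
  have "real (if w (\<alpha> i) \<in> pos_roots then Suc 0 else 0) \<le> wall q w i x
      \<longleftrightarrow> affine_value (affine_simple i) (u z) > 0" if i: "i \<le> DIM('a)" for i
  proof -
    have \<beta>: "w (\<alpha> i) \<in> \<Phi>" using w alpha_root[OF i] by (rule weyl_root)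
    obtain k where k: "wall q w i x = of_int k" using wall_Ints[OF w x i] by (auto elim: Ints_cases)
    have "\<alpha> i \<bullet> u z = w (\<alpha> i) \<bullet> z" using inner_weyl[OF w, of "\<alpha> i" "u z"] u(3) by simp
    then have "affine_value (affine_simple i) (u z) = (wall q w i x - w (\<alpha> i) \<bullet> \<rho> / cox) / of_int q"
      using q by (simp add: affine_simple_value z_def wall_def inner_diff_right field_simps)
    then have "affine_value (affine_simple i) (u z) > 0 \<longleftrightarrow> w (\<alpha> i) \<bullet> \<rho> / cox < of_int k"
      using q by (simp add: k zero_less_divide_iff)
    then show ?thesis using height_less_iff[OF \<beta>, of k] by (auto simp: k)
  qed
  then have "x \<in> cell q 0 w \<longleftrightarrow> u z \<in> alcove" using x by (auto simp: cell_def)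
  also have "\<dots> \<longleftrightarrow> (\<exists>y\<in>alcove. z = w y)"
  proof
    show "u z \<in> alcove \<Longrightarrow> \<exists>y\<in>alcove. z = w y" by (rule bexI[of _ "u z"]) (simp_all add: u)
    show "\<exists>y\<in>alcove. z = w y \<Longrightarrow> u z \<in> alcove" using u(2) by auto
  qed
  finally show ?thesis unfolding z_def .
qed

text \<open>The displaced and rescaled coweight lies on no affine hyperplane, since roots take
  integral values at \<open>x\<close> but not at \<open>(1 / cox) *\<^sub>R \<rho>\<close>. Hence it
  lies in some alcove.\<close>

lemma cell_exists:
  assumes q: "q > 0" and x: "x \<in> coweights"
  obtains v w where "v \<in> coroots" "w \<in> weyl_group \<Phi>" "x - of_int q *\<^sub>R v \<in> cell q 0 w"
proof -
  define z where "z = (1 / real_of_int q) *\<^sub>R (x - (1 / cox) *\<^sub>R \<rho>)"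
  have "affine_value p z \<noteq> 0" if p: "p \<in> affine_roots" for p
  proof
    have \<beta>: "fst p \<in> \<Phi>" using p by auto
    assume "affine_value p z = 0"
    then have "fst p \<bullet> \<rho> / cox = fst p \<bullet> x + of_int (snd p * q)"
      using q by (simp add: affine_value_def z_def inner_diff_right field_simps)
    also have "\<dots> \<in> \<int>" using root_coweight_Ints[OF x \<beta>] by simp
    finally show False using root_height_bounds(2)[OF \<beta>] by blast
  qed
  then obtain v w y where v: "v \<in> coroots" and w: "w \<in> weyl_group \<Phi>" and y: "y \<in> alcove" "z = v + w y"
    by (rule alcove_exists[of z]) blast+
  have "x - of_int q *\<^sub>R v \<in> coweights"
    by (intro coweight_diff x coweight_mult coroot_coweight v)
  moreover have "(1 / of_int q) *\<^sub>R (x - of_int q *\<^sub>R v - (1 / cox) *\<^sub>R \<rho>) = z - v"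
    using q by (simp add: z_def algebra_simps)
  ultimately have "x - of_int q *\<^sub>R v \<in> cell q 0 w"
    using y by (subst cell_0_iff[OF q w]) auto
  then show ?thesis using that v w by blast
qed

lemma cell_unique:
  assumes q: "q > 0" and w: "w \<in> weyl_group \<Phi>" "w' \<in> weyl_group \<Phi>"
    and x: "x \<in> cell q 0 w" "x' \<in> cell q 0 w'"
    and v: "v \<in> coroots" "x = x' + of_int q *\<^sub>R v"
  shows "w = w'" "v = 0"
proof -
  have "x \<in> coweights" "x' \<in> coweights" using x by (auto simp: cell_def)
  then obtain y y' where y: "y \<in> alcove" "(1 / of_int q) *\<^sub>R (x - (1 / cox) *\<^sub>R \<rho>) = w y"
    and y': "y' \<in> alcove" "(1 / of_int q) *\<^sub>R (x' - (1 / cox) *\<^sub>R \<rho>) = w' y'"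
    using x cell_0_iff[OF q] w by meson
  have "0 + w y = v + w' y'"
    using q unfolding y(2)[symmetric] y'(2)[symmetric] v(2) by (simp add: algebra_simps)
  from alcove_unique[OF coroot_lattice_0 w(1) y(1) v(1) w(2) y'(1) this]
  show "w = w'" "v = 0" by simp_all
qed

section \<open>Avoiding the arrangement modulo \<open>q\<close>\<close>

definition uncovered :: "int \<Rightarrow> nat \<Rightarrow> 'a \<Rightarrow> bool" where
  "uncovered q n x \<longleftrightarrow> (\<forall>\<beta>\<in>pos_roots. \<forall>k\<in>{1..int n}. \<not> [\<beta> \<bullet> x = of_int k] (rmod of_int q))"

lemma uncovered_translate:
  assumes "uncovered q n x" "z \<in> coweights"
  shows "uncovered q n (x + of_int q *\<^sub>R z)"
  unfolding uncovered_def
proof (intro ballI notI)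
  fix \<beta> k assume \<beta>: "\<beta> \<in> pos_roots" and k: "k \<in> {1..int n}"
    and cong: "[\<beta> \<bullet> (x + of_int q *\<^sub>R z) = of_int k] (rmod of_int q)"
  have "\<beta> \<in> \<Phi>" using \<beta> by (simp add: positive_roots_def)
  then obtain a where a: "\<beta> \<bullet> z = of_int a" using root_coweight_Ints[OF assms(2)] by (auto elim: Ints_cases)
  obtain b where "of_int k = \<beta> \<bullet> (x + of_int q *\<^sub>R z) + of_int b * of_int q"
    using cong unfolding rcong_altdef by blast
  then have "of_int k = \<beta> \<bullet> x + of_int (a + b) * of_int q"
    by (simp add: inner_add_right a algebra_simps)
  then have "[\<beta> \<bullet> x = of_int k] (rmod of_int q)" unfolding rcong_altdef by blast
  then show False using assms(1) \<beta> k by (simp add: uncovered_def)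
qed

lemma uncovered_iff_cell:
  assumes w: "w \<in> weyl_group \<Phi>" and x: "x \<in> cell q 0 w"
  shows "uncovered q n x \<longleftrightarrow> x \<in> cell q n w"
proof
  have xZ: "x \<in> coweights" using x by (simp add: cell_def)
  assume unc: "uncovered q n x"
  \<comment> \<open>At an ascent the wall itself is a positive root modulo \<open>q\<close>: the
    \<open>q\<close> added for \<open>i = 0\<close> is invisible, so a value from 1 to
    \<open>n\<close> would be forbidden.\<close>
  have "real (Suc n) \<le> wall q w i x" if i: "i \<le> DIM('a)" "w (\<alpha> i) \<in> pos_roots" for i
  proof (rule ccontr)
    assume less: "\<not> ?thesis"
    obtain k where k: "wall q w i x = of_int k" using wall_Ints[OF w xZ i(1)] by (auto elim: Ints_cases)
    have "of_int k \<ge> (1 :: real)" using x i by (force simp: cell_def k)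
    moreover have "real_of_int k < of_int (int n + 1)" using less by (simp add: k)
    ultimately have "k \<in> {1..int n}" unfolding of_int_less_iff by simp
    moreover have "of_int k = w (\<alpha> i) \<bullet> x + of_int (if i = 0 then 1 else 0) * of_int q"
      by (simp add: k[symmetric] wall_def)
    then have "[w (\<alpha> i) \<bullet> x = of_int k] (rmod of_int q)" unfolding rcong_altdef by blast
    ultimately show False using unc i(2) unfolding uncovered_def by blast
  qed
  then show "x \<in> cell q n w" using x by (auto simp: cell_def split: if_splits)
next
  assume xn: "x \<in> cell q n w"
  obtain u where u: "u \<in> weyl_group \<Phi>" "\<And>x. u (w x) = x" "\<And>x. w (u x) = x"
    by (rule weyl_inverse[OF w]) (rule that; assumption)
  show "uncovered q n x"
    unfolding uncovered_def
  proof (intro ballI notI)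
    fix \<beta> k assume \<beta>: "\<beta> \<in> pos_roots" and k: "k \<in> {1..int n}" and cong: "[\<beta> \<bullet> x = of_int k] (rmod of_int q)"
    have \<beta>\<Phi>: "\<beta> \<in> \<Phi>" using \<beta> by (simp add: positive_roots_def)
    obtain b where b: "of_int k = \<beta> \<bullet> x + of_int b * of_int q"
      using cong unfolding rcong_altdef by blast
    \<comment> \<open>The multiple \<open>b\<close> of \<open>q\<close> in the congruence becomes
      the constant term, so that \<open>k\<close> is an integral combination of the walls of the
      cell.\<close>
    obtain m :: "nat \<Rightarrow> int" where m: "u \<beta> = (\<Sum>i\<le>DIM('a). of_int (m i) *\<^sub>R \<alpha> i)" "m 0 = b"
      and sgn: "(\<forall>i\<le>DIM('a). m i \<ge> 0) \<or> (\<forall>i\<le>DIM('a). m i \<le> 0)"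
      using affine_root_coeffs[OF weyl_root[OF u(1) \<beta>\<Phi>]] by blast
    have "of_int k = u \<beta> \<bullet> u x + of_int b * of_int q" using b inner_weyl[OF u(1)] by simp
    also have "\<dots> = (\<Sum>i\<le>DIM('a). of_int (m i) * wall q w i x)"
      unfolding affine_coeffs_value[OF m] wall_weyl[OF w, of q _ "u x", symmetric] u(3) ..
    finally have ksum: "of_int k = (\<Sum>i\<le>DIM('a). of_int (m i) * wall q w i x)" .
    have wall_nonneg: "wall q w i x \<ge> 0" if "i \<le> DIM('a)" for i
      using xn that unfolding cell_def by (auto intro: order_trans[OF of_nat_0_le_iff])
    \<comment> \<open>The wall values are nonnegative and \<open>k\<close> is positive, which
      excludes the negative sign.\<close>
    have nn: "\<forall>i\<le>DIM('a). m i \<ge> 0"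
    proof (rule ccontr)
      assume "\<not> ?thesis"
      then have "(\<Sum>i\<le>DIM('a). of_int (m i) * wall q w i x) \<le> 0"
        using sgn wall_nonneg by (intro sum_nonpos mult_nonpos_nonneg) auto
      then show False using ksum k by auto
    qed
    \<comment> \<open>Otherwise \<open>\<beta>\<close> would be a nonnegative combination of
      negative roots and have height at most 0. The term of such a \<open>j\<close> alone already
      exceeds \<open>n\<close>.\<close>
    have "\<exists>j\<le>DIM('a). m j > 0 \<and> w (\<alpha> j) \<in> pos_roots"
    proof (rule ccontr)
      assume none: "\<not> ?thesis"
      have "\<beta> = w (u \<beta>)" by (simp add: u)
      also have "\<dots> = (\<Sum>i\<le>DIM('a). of_int (m i) *\<^sub>R w (\<alpha> i))"
        unfolding m(1) using linear_weyl[OF w] by (simp add: linear_sum linear_scale)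
      finally have "\<beta> \<bullet> \<rho> = (\<Sum>i\<le>DIM('a). of_int (m i) * (w (\<alpha> i) \<bullet> \<rho>))"
        by (simp add: inner_sum_left)
      also have "\<dots> \<le> 0"
      proof (intro sum_nonpos)
        fix i assume "i \<in> {..DIM('a)}"
        then have i: "i \<le> DIM('a)" by simp
        show "of_int (m i) * (w (\<alpha> i) \<bullet> \<rho>) \<le> 0"
        proof (cases "m i > 0")
          case True
          then have "w (\<alpha> i) \<bullet> \<rho> \<le> 0"
            using none i pos_root_iff_height[OF weyl_root[OF w alpha_root[OF i]]] by auto
          then show ?thesis using True by (simp add: mult_nonneg_nonpos)
        next
          case False
          then have "m i = 0" using nn i by (meson antisym not_le)
          then show ?thesis by simp
        qed
      qed
      finally show False using pos_root_height(1)[OF \<beta>] by simp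
    qed
    then obtain j where j: "j \<le> DIM('a)" "m j > 0" "w (\<alpha> j) \<in> pos_roots" by blast
    have "real (Suc n) \<le> wall q w j x" using xn j unfolding cell_def by auto
    also have "\<dots> \<le> of_int (m j) * wall q w j x"
      using j(2) wall_nonneg[OF j(1)] mult_right_mono[of 1 "real_of_int (m j)"] by simp
    also have "\<dots> \<le> (\<Sum>i\<le>DIM('a). of_int (m i) * wall q w i x)"
      using j(1) nn wall_nonneg by (intro member_le_sum) auto
    finally have "real_of_int (int (Suc n)) \<le> of_int k" by (simp add: ksum)
    then show False using k unfolding of_int_le_iff by simp
  qed
qed

section \<open>Classes of coweights and the factor \<open>lattice_index\<close>\<close>

abbreviation same_class :: "'a set \<Rightarrow> ('a \<times> 'a) set" where
  "same_class M \<equiv> {(x, y). x \<in> coweights \<and> y \<in> coweights \<and> x - y \<in> M}"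

lemma equiv_same_class:
  assumes "0 \<in> M" "\<And>x. x \<in> M \<Longrightarrow> - x \<in> M" "\<And>x y. x \<in> M \<Longrightarrow> y \<in> M \<Longrightarrow> x + y \<in> M"
  shows "equiv coweights (same_class M)"
proof (rule equivI)
  show "same_class M \<subseteq> coweights \<times> coweights" by auto
  show "refl_on coweights (same_class M)" using assms(1) by (auto intro: refl_onI)
  show "sym (same_class M)" using assms(2) by (auto intro!: symI) (metis minus_diff_eq)
  show "trans (same_class M)"
  proof (rule transI)
    fix x y z assume "(x, y) \<in> same_class M" "(y, z) \<in> same_class M"
    then show "(x, z) \<in> same_class M" using assms(3)[of "x - y" "y - z"] by simp
  qed
qed

lemma equiv_coroots: "equiv coweights (same_class coroots)"
  using coroot_lattice_0 coroot_lattice_uminus coroot_lattice_add by (rule equiv_same_class)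

lemma equiv_dilated: "equiv coweights (same_class ((*\<^sub>R) (of_int q) ` coweights))"
proof (rule equiv_same_class)
  show "0 \<in> (*\<^sub>R) (of_int q) ` coweights" using coweight_0 by force
  show "- x \<in> (*\<^sub>R) (of_int q) ` coweights" if "x \<in> (*\<^sub>R) (of_int q) ` coweights" for x
    using that coweight_uminus by (auto simp: scaleR_minus_right[symmetric] simp del: scaleR_minus_right)
  show "x + y \<in> (*\<^sub>R) (of_int q) ` coweights"
    if "x \<in> (*\<^sub>R) (of_int q) ` coweights" "y \<in> (*\<^sub>R) (of_int q) ` coweights" for x y
    using that coweight_add by (auto simp: scaleR_add_right[symmetric] simp del: scaleR_add_right)
qed

text \<open>
  Modulo the lattice \<open>q\<close> times \<open>coroots\<close> every coweight lies in exactly one cell, so the cells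
  meet a class modulo \<open>q\<close> times \<open>coweights\<close> in as many points as there are classes of
  coweights modulo \<open>coroots\<close>.
\<close>

lemma bij_betw_fibre:
  assumes q: "q > 0" and x0: "x0 \<in> coweights" "uncovered q n x0"
  defines "R \<equiv> same_class ((*\<^sub>R) (of_int q) ` coweights)"
  shows "bij_betw (\<lambda>(w, x). same_class coroots `` {(1 / of_int q) *\<^sub>R (x - x0)})
    {p \<in> Sigma (weyl_group \<Phi>) (cell q n). R `` {snd p} = R `` {x0}}
    (coweights // same_class coroots)" (is "bij_betw ?f ?F _")
proof -
  \<comment> \<open>The class of \<open>x0\<close> consists of the points \<open>x0 + q z\<close>;
    the map reads off \<open>z\<close> modulo the coroots.\<close>
  have class_iff: "R `` {x} = R `` {x0} \<longleftrightarrow> (\<exists>z\<in>coweights. x = x0 + of_int q *\<^sub>R z)"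
    if "x \<in> coweights" for x
  proof -
    have "R `` {x} = R `` {x0} \<longleftrightarrow> (x, x0) \<in> R"
      unfolding R_def using equiv_dilated that x0(1) by (rule eq_equiv_class_iff)
    also have "\<dots> \<longleftrightarrow> (\<exists>z\<in>coweights. x = x0 + of_int q *\<^sub>R z)"
      using that x0 by (auto simp: R_def image_iff algebra_simps)
    finally show ?thesis .
  qed
  have scale: "(1 / of_int q) *\<^sub>R (x0 + of_int q *\<^sub>R z - x0) = z" for z :: 'a
    using q by simp
  show ?thesis
    unfolding bij_betw_def
  proof (intro conjI inj_onI equalityI subsetI)
    fix p p' assume p: "p \<in> ?F" "p' \<in> ?F" and eq: "?f p = ?f p'"
    obtain w x w' x' where pp: "p = (w, x)" "p' = (w', x')" by (cases p, cases p') blast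
    have w: "w \<in> weyl_group \<Phi>" "w' \<in> weyl_group \<Phi>" and c: "x \<in> cell q n w" "x' \<in> cell q n w'"
      using p pp by auto
    then have "x \<in> coweights" "x' \<in> coweights" by (auto simp: cell_def)
    then obtain z z' where z: "z \<in> coweights" "x = x0 + of_int q *\<^sub>R z"
      and z': "z' \<in> coweights" "x' = x0 + of_int q *\<^sub>R z'"
      using class_iff p pp by auto
    have "same_class coroots `` {z} = same_class coroots `` {z'}"
      using eq by (simp only: pp z(2) z'(2) scale prod.case)
    then have "z - z' \<in> coroots"
      using eq_equiv_class_iff[OF equiv_coroots z(1) z'(1)] by simp
    moreover have "x = x' + of_int q *\<^sub>R (z - z')" by (simp add: z(2) z'(2) algebra_simps)
    ultimately have "w = w'" "z - z' = 0"
      by (rule cell_unique[OF q w subsetD[OF cell_mono c(1)] subsetD[OF cell_mono c(2)]])+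
    then show "p = p'" using pp z(2) z'(2) by simp
  next
    fix Y assume "Y \<in> ?f ` ?F"
    then obtain w x where x: "x \<in> cell q n w" "R `` {x} = R `` {x0}"
      "Y = same_class coroots `` {(1 / of_int q) *\<^sub>R (x - x0)}" by auto
    then obtain z where z: "z \<in> coweights" "x = x0 + of_int q *\<^sub>R z"
      using class_iff by (auto simp: cell_def)
    then have "Y = same_class coroots `` {z}" using x(3) by (simp only: scale)
    then show "Y \<in> coweights // same_class coroots" using z(1) by (simp only: quotientI)
  next
    fix Y assume "Y \<in> coweights // same_class coroots"
    then obtain z where z: "Y = same_class coroots `` {z}" "z \<in> coweights" by (rule quotientE)
    \<comment> \<open>Translating by \<open>q v\<close> with \<open>v\<close> a coroot moves the
      point into a cell and leaves the class of \<open>z\<close> unchanged. The point inherits from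
      \<open>x0\<close> that it is uncovered, so it even satisfies the bounds for
      \<open>n\<close>.\<close>
    have "x0 + of_int q *\<^sub>R z \<in> coweights" by (intro coweight_add coweight_mult x0 z)
    from cell_exists[OF q this] obtain v w where v: "v \<in> coroots" and w: "w \<in> weyl_group \<Phi>"
      and c: "x0 + of_int q *\<^sub>R z - of_int q *\<^sub>R v \<in> cell q 0 w" by blast
    have x: "x0 + of_int q *\<^sub>R z - of_int q *\<^sub>R v = x0 + of_int q *\<^sub>R (z - v)"
      by (simp add: algebra_simps)
    have zv: "z - v \<in> coweights" by (rule coweight_diff[OF z(2) coroot_coweight[OF v]])
    let ?x = "x0 + of_int q *\<^sub>R (z - v)"
    have "?x \<in> cell q n w"
      using uncovered_iff_cell[OF w c[unfolded x]] uncovered_translate[OF x0(2) zv] by blast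
    moreover from this have "R `` {?x} = R `` {x0}" using class_iff[of ?x] zv by (auto simp: cell_def)
    ultimately have "(w, ?x) \<in> ?F" using w by simp
    moreover have "(z, z - v) \<in> same_class coroots" using z(2) zv v by simp
    then have "Y = same_class coroots `` {z - v}"
      unfolding z(1) by (rule equiv_class_eq[OF equiv_coroots])
    then have "Y = ?f (w, ?x)" by (simp only: prod.case scale)
    ultimately show "Y \<in> ?f ` ?F" by blast
  qed
qed

text \<open>Double counting: pairs of a Weyl group element and a point of its cell are sorted by the
  class of the point modulo \<open>q\<close> times the coweights. Exactly the uncovered classes
  occur, each with a fibre of \<open>lattice_index\<close> elements.\<close>

lemma index_times_complement_count:
  assumes q: "q > 0"
  shows "lattice_index \<Phi> \<alpha> * complement_count \<Phi> \<alpha> 1 (int n) q = (\<Sum>w\<in>weyl_group \<Phi>. card (cell q n w))"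
proof -
  define R where "R = same_class ((*\<^sub>R) (of_int q) ` coweights)"
  define B where "B = Sigma (weyl_group \<Phi>) (cell q n)"
  define \<phi> where "\<phi> = (\<lambda>p :: ('a \<Rightarrow> 'a) \<times> 'a. R `` {snd p})"
  define C where "C = {X \<in> coweights // R. \<forall>x\<in>X. uncovered q n x}"
  have finB: "finite B" unfolding B_def using finite_weyl card_cell(1) by auto
  have quot: "coweights // same_class coroots \<noteq> {}"
    using coweight_0 unfolding quotient_is_empty by blast
  \<comment> \<open>Nonemptiness gives surjectivity onto \<open>C\<close>. It comes from the
    nonempty quotient, since at this stage a zero \<open>card\<close> could also mean an infinite
    set.\<close>
  have fibre: "card {p \<in> B. \<phi> p = X} = lattice_index \<Phi> \<alpha>" "{p \<in> B. \<phi> p = X} \<noteq> {}" if X: "X \<in> C" for X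
  proof -
    have "X \<in> coweights // R" using X by (simp add: C_def)
    then obtain x0 where x0: "X = R `` {x0}" "x0 \<in> coweights" by (rule quotientE)
    have "x0 \<in> X" unfolding x0(1) R_def using x0(2) by (rule equiv_class_self[OF equiv_dilated])
    then have "uncovered q n x0" using X by (simp add: C_def)
    from bij_betw_fibre[OF q x0(2) this]
    have bij: "bij_betw (\<lambda>(w, x). same_class coroots `` {(1 / of_int q) *\<^sub>R (x - x0)}) {p \<in> B. \<phi> p = X}
      (coweights // same_class coroots)"
      unfolding B_def \<phi>_def R_def x0(1) .
    show "card {p \<in> B. \<phi> p = X} = lattice_index \<Phi> \<alpha>"
      using bij_betw_same_card[OF bij] by (simp add: lattice_index_def lattice_quotient_def)
    show "{p \<in> B. \<phi> p = X} \<noteq> {}" using quot unfolding bij_betw_imp_surj_on[OF bij, symmetric] image_is_empty .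
  qed
  have "\<phi> ` B = C"
  proof (intro equalityI subsetI)
    fix X assume "X \<in> \<phi> ` B"
    then obtain w x where w: "w \<in> weyl_group \<Phi>" and x: "x \<in> cell q n w" and X: "X = R `` {x}"
      by (auto simp: B_def \<phi>_def)
    have unc: "uncovered q n x" using uncovered_iff_cell[OF w subsetD[OF cell_mono x]] x by blast
    have xZ: "x \<in> coweights" using x by (simp add: cell_def)
    have "uncovered q n y" if y: "y \<in> X" for y
    proof -
      obtain z where "z \<in> coweights" "x - y = of_int q *\<^sub>R z" using y unfolding X R_def by auto
      then have "y = x + of_int q *\<^sub>R (- z)" "- z \<in> coweights"
        using coweight_uminus by (auto simp: algebra_simps)
      then show ?thesis by (simp only: uncovered_translate[OF unc])
    qed
    moreover have "X \<in> coweights // R" unfolding X using xZ by (rule quotientI)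
    ultimately show "X \<in> C" by (simp add: C_def)
  next
    fix X assume "X \<in> C"
    then show "X \<in> \<phi> ` B" using fibre(2) by blast
  qed
  have "(\<Sum>w\<in>weyl_group \<Phi>. card (cell q n w)) = card B"
    unfolding B_def using finite_weyl card_cell(1) by (simp add: card_SigmaI)
  also have "\<dots> = (\<Sum>X\<in>\<phi> ` B. card {p \<in> B. \<phi> p = X})"
    using sum.image_gen[OF finB, of "\<lambda>_. 1 :: nat" \<phi>] by simp
  also have "\<dots> = card C * lattice_index \<Phi> \<alpha>"
    unfolding \<open>\<phi> ` B = C\<close> using fibre(1) by simp
  also have "card C = complement_count \<Phi> \<alpha> 1 (int n) q"
    unfolding C_def complement_count_def lattice_quotient_def R_def uncovered_def ..
  finally show ?thesis by (simp add: mult.commute)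
qed

text \<open>For \<open>q = 1\<close> and \<open>n = 0\<close> nothing is forbidden, and the fibre
  bijection identifies the quotient with a subset of the finite union of cells.\<close>

lemma lattice_index_pos: "lattice_index \<Phi> \<alpha> > 0"
proof -
  let ?R = "same_class ((*\<^sub>R) (of_int 1) ` coweights)"
  have "uncovered 1 0 0" by (simp add: uncovered_def)
  from bij_betw_fibre[OF _ coweight_0 this]
  have bij: "bij_betw (\<lambda>(w, x). same_class coroots `` {(1 / of_int 1) *\<^sub>R (x - 0)})
      {p \<in> Sigma (weyl_group \<Phi>) (cell 1 0). ?R `` {snd p} = ?R `` {0}} (coweights // same_class coroots)"
    by simp
  have "finite (Sigma (weyl_group \<Phi>) (cell 1 0))" using finite_weyl card_cell(1) by auto
  then have "finite (coweights // same_class coroots)"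
    unfolding bij_betw_finite[OF bij, symmetric] by simp
  moreover have "coweights // same_class coroots \<noteq> {}"
    using coweight_0 unfolding quotient_is_empty by blast
  ultimately show ?thesis by (simp add: lattice_index_def lattice_quotient_def card_gt_0_iff)
qed

section \<open>The closed alcove and its Ehrhart count\<close>

lemma closure_fundamental_alcove:
  "closure (fundamental_alcove \<alpha> \<theta>) = {x. \<forall>i\<le>DIM('a). \<alpha> i \<bullet> x + (if i = 0 then 1 else 0) \<ge> 0}" (is "_ = ?C")
proof (intro equalityI subsetI)
  have "?C = (\<Inter>i\<in>{..DIM('a)}. {x. \<alpha> i \<bullet> x + (if i = 0 then 1 else 0) \<ge> 0})" by blast
  then have "closed ?C" by (simp only:) (intro closed_INT ballI closed_Collect_le continuous_intros)
  moreover have "fundamental_alcove \<alpha> \<theta> \<subseteq> ?C"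
  proof
    fix x assume x: "x \<in> fundamental_alcove \<alpha> \<theta>"
    have "\<alpha> i \<bullet> x + (if i = 0 then 1 else 0) \<ge> 0" if "i \<le> DIM('a)" for i
      using x that by (cases "i = 0") (auto simp: fundamental_alcove_def alpha_0 less_imp_le)
    then show "x \<in> ?C" by blast
  qed
  ultimately show "x \<in> ?C" if "x \<in> closure (fundamental_alcove \<alpha> \<theta>)" for x
    using closure_minimal that by blast
next
  fix x assume x: "x \<in> ?C"
  \<comment> \<open>By convexity the points of the segment from \<open>x\<close> to the centre
    \<open>z\<close>, other than \<open>x\<close> itself, are interior; the sequence
    \<open>y\<close> runs along it towards \<open>x\<close>.\<close>
  define z where "z = (1 / cox) *\<^sub>R \<rho>"
  define y where "y = (\<lambda>n. x + inverse (real (Suc n)) *\<^sub>R (z - x))"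
  have pos: "\<alpha> i \<bullet> y n + (if i = 0 then 1 else 0) > 0" if i: "i \<le> DIM('a)" for i n
  proof -
    let ?t = "inverse (real (Suc n))" and ?k = "if i = 0 then 1 else 0 :: real"
    have t: "0 < ?t" "?t \<le> 1" by (simp_all add: inverse_le_1_iff)
    have "\<alpha> i \<bullet> y n + ?k = (1 - ?t) * (\<alpha> i \<bullet> x + ?k) + ?t * affine_value (affine_simple i) z"
      by (simp only: y_def affine_simple_value inner_add_right inner_diff_right inner_scaleR_right) algebra
    moreover have "affine_value (affine_simple i) z > 0"
      using affine_simple_center[OF i] cox_gt_1 by (simp add: z_def)
    moreover have "\<alpha> i \<bullet> x + ?k \<ge> 0" using x i by blast
    ultimately show ?thesis using t by (simp add: add_nonneg_pos)
  qed
  have "y n \<in> fundamental_alcove \<alpha> \<theta>" for n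
  proof -
    have "\<alpha> i \<bullet> y n > 0" if "i \<in> {1..DIM('a)}" for i using pos[of i n] that by simp
    moreover have "\<theta> \<bullet> y n < 1" using pos[of 0 n] by (simp add: alpha_0)
    ultimately show ?thesis by (simp add: fundamental_alcove_def)
  qed
  moreover have "y \<longlonglongrightarrow> x + 0 *\<^sub>R (z - x)"
    unfolding y_def by (intro tendsto_intros LIMSEQ_inverse_real_of_nat)
  ultimately show "x \<in> closure (fundamental_alcove \<alpha> \<theta>)"
    unfolding closure_sequential by auto
qed

lemma card_dilated_alcove:
  assumes q: "q > 0"
  shows "card ((*\<^sub>R) (of_int q) ` closure (fundamental_alcove \<alpha> \<theta>) \<inter> coweights) = card (solutions c DIM('a) q)"
proof -
  have "x \<in> (*\<^sub>R) (of_int q) ` closure (fundamental_alcove \<alpha> \<theta>) \<longleftrightarrow> (\<forall>i\<le>DIM('a). real 0 \<le> wall q id i x)" for x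
  proof -
    have "x \<in> (*\<^sub>R) (of_int q) ` closure (fundamental_alcove \<alpha> \<theta>)
        \<longleftrightarrow> (1 / of_int q) *\<^sub>R x \<in> closure (fundamental_alcove \<alpha> \<theta>)"
      using q by (auto simp: image_iff intro!: bexI[of _ "(1 / of_int q) *\<^sub>R x"])
    also have "\<dots> \<longleftrightarrow> (\<forall>i\<le>DIM('a). real 0 \<le> wall q id i x)"
    proof -
      have "\<alpha> i \<bullet> (1 / of_int q) *\<^sub>R x + (if i = 0 then 1 else 0) = wall q id i x / of_int q" for i
        using q by (simp add: wall_def add_divide_distrib)
      then show ?thesis
        unfolding closure_fundamental_alcove using q by (simp add: zero_le_divide_iff)
    qed
    finally show ?thesis .
  qed
  then have "(*\<^sub>R) (of_int q) ` closure (fundamental_alcove \<alpha> \<theta>) \<inter> coweights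
      = {x \<in> coweights. \<forall>i\<le>DIM('a). real 0 \<le> wall q id i x}" by blast
  then show ?thesis using card_simplex(2)[OF weyl_id, of "\<lambda>_. 0" q] by simp
qed

end

theorem theorem5p2:
  fixes \<Phi> :: "'a::euclidean_space set"
    and \<alpha> :: "nat \<Rightarrow> 'a" and \<theta> :: 'a
    and c :: "nat \<Rightarrow> nat" and n :: nat and q :: int
  assumes "irreducible_root_system \<Phi>"
    and "simple_roots \<Phi> \<alpha>"
    and "highest_root \<Phi> \<alpha> \<theta>"
    and "\<theta> = (\<Sum>i=1..DIM('a). real (c i) *\<^sub>R \<alpha> i)"
    and "\<alpha> 0 = - \<theta>" and "c 0 = 1"
    and "n \<ge> 1"
  shows "char_quasi_polynomial \<Phi> \<alpha> 1 (int n) q =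
         poly_op (eulerian_poly \<Phi> \<alpha> c) (shift ^^ (n + 1)) (alcove_ehrhart \<alpha> \<theta>) q"
proof -
  interpret highest_root_system \<Phi> \<alpha> \<theta> c
    using assms by unfold_locales (auto simp: irreducible_root_system_def)
  obtain G where G: "quasi_polynomial G" "\<And>m. m \<ge> 0 \<Longrightarrow> real (card (solutions c DIM('a) m)) = G m"
    using denumerant_quasi_polynomial[of "DIM('a)" c] c_pos c_0 by blast
  have "alcove_ehrhart \<alpha> \<theta> = G"
    unfolding alcove_ehrhart_def
  proof (rule the_equality)
    show "quasi_polynomial G \<and> (\<forall>q>0. G q = real (card ((*\<^sub>R) (of_int q) ` closure (fundamental_alcove \<alpha> \<theta>) \<inter> coweights)))"
      using G card_dilated_alcove by simp
    fix g assume g: "quasi_polynomial g \<and> (\<forall>q>0. g q = real (card ((*\<^sub>R) (of_int q) ` closure (fundamental_alcove \<alpha> \<theta>) \<inter> coweights)))"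
    \<comment> \<open>Agreement at positive arguments determines the quasi-polynomial, so
      \<open>G\<close> also supplies the values of the Ehrhart function at arguments
      \<open>q \<le> 0\<close>.\<close>
    have "eventually (\<lambda>q. g q = G q) at_top"
      using eventually_gt_at_top[of 0] by eventually_elim (use g G card_dilated_alcove in simp)
    then show "g = G" using g G(1) by (intro quasi_polynomial_eqI) auto
  qed
  define g where "g = (\<lambda>q. 1 / real (lattice_index \<Phi> \<alpha>) * (\<Sum>w\<in>weyl_group \<Phi>. G (q - int ((n + 1) * asc \<Phi> \<alpha> c w))))"
  have qg: "quasi_polynomial g"
    unfolding g_def by (intro quasi_polynomial_cmult quasi_polynomial_sum quasi_polynomial_translate G)
  \<comment> \<open>From here on each \<open>q - (n + 1) asc w\<close> is nonnegative, so
    \<open>G\<close> counts solutions there; the final 1 ensures \<open>q > 0\<close>.\<close>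
  define N where "N = int (\<Sum>w\<in>weyl_group \<Phi>. (n + 1) * asc \<Phi> \<alpha> c w) + 1"
  have "g q = real (complement_count \<Phi> \<alpha> 1 (int n) q)" if q: "q \<ge> N" for q
  proof -
    have "q - int ((n + 1) * asc \<Phi> \<alpha> c w) \<ge> 0" if "w \<in> weyl_group \<Phi>" for w
    proof -
      have "(n + 1) * asc \<Phi> \<alpha> c w \<le> (\<Sum>w\<in>weyl_group \<Phi>. (n + 1) * asc \<Phi> \<alpha> c w)"
        using that finite_weyl by (intro member_le_sum) auto
      then show ?thesis using q unfolding N_def by linarith
    qed
    then have "G (q - int ((n + 1) * asc \<Phi> \<alpha> c w)) = real (card (cell q n w))" if "w \<in> weyl_group \<Phi>" for w
      using that by (simp only: card_cell(2) G(2) Suc_eq_plus1)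
    then have "g q = 1 / real (lattice_index \<Phi> \<alpha>) * real (\<Sum>w\<in>weyl_group \<Phi>. card (cell q n w))"
      by (simp add: g_def)
    also have "q > 0" using q unfolding N_def by linarith
    note index_times_complement_count[OF this, of n, symmetric]
    finally show ?thesis using lattice_index_pos by simp
  qed
  then have ev: "eventually (\<lambda>q. g q = real (complement_count \<Phi> \<alpha> 1 (int n) q)) at_top"
    unfolding eventually_at_top_linorder by blast
  have "char_quasi_polynomial \<Phi> \<alpha> 1 (int n) = g"
    unfolding char_quasi_polynomial_def
  proof (rule the_equality)
    show "quasi_polynomial g \<and> eventually (\<lambda>q. g q = real (complement_count \<Phi> \<alpha> 1 (int n) q)) at_top"
      using qg ev by blast
    fix h assume h: "quasi_polynomial h \<and> eventually (\<lambda>q. h q = real (complement_count \<Phi> \<alpha> 1 (int n) q)) at_top"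
    then have "eventually (\<lambda>q. h q = g q) at_top" using ev by (auto elim: eventually_elim2)
    then show "h = g" using h qg by (intro quasi_polynomial_eqI) auto
  qed
  then show ?thesis
    unfolding eulerian_poly_def poly_op_shift_monom_sum[OF finite_weyl] \<open>alcove_ehrhart \<alpha> \<theta> = G\<close>
    by (simp only: g_def)
qed

end
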